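(* Consider the distributed online problem and the DOPP algorithm described in the context. Suppose the network assumptions (N1)–(N3) and the problem assumptions (P1)–(P4) of the context hold. Let $\alpha_0=1,\ \beta_0=1$ and, for $t\ge 1$, $$\alpha_t=\frac{1}{\sqrt t},\qquad \beta_t=\frac{1}{t^{\kappa}},$$ where $\kappa\in(0,1/4)$ is a constant. Then the iterates of DOPP satisfy, for $T\ge 4$, $$Reg(T)=O_+\big(T^{\frac12+2\kappa}\big)+O_+(V_T),\qquad Reg^c(T)=O\big(T^{1-\frac{\kappa}{2}}\big),$$ where $$V_T:=\sum_{t=1}^T\frac{1}{\alpha_t}\sum_{i=1}^N\|x_{i,t+1}^*-x_{i,t}^*\|.$$ Moreover, in the worst case when $x_t=col(x_{1,t},\ldots,x_{N,t})$ is always infeasible, in the sense that $\sum_{i=1}^N g_i(x_{i,t})>\mathbf 0$ (componentwise) for all $t\in[T]$, one has $$Reg(T)=\Omega\big(-T^{1-\frac{\kappa}{2}}\big).$$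
   Context: Notation. $[N]=\{1,\ldots,N\}$; $\|\cdot\|$ is the Euclidean norm (induced norm for matrices); vector (in)equalities are componentwise; $[z]_+$ is the componentwise projection of $z$ onto the nonnegative orthant; $P_S$ is Euclidean projection onto a closed convex set $S$; $col(\cdot)$ stacks column vectors; $\partial h(x)$ is the subdifferential of a convex function $h$ at $x$. For a vector-valued componentwise convex $h:\mathbb R^{n}\to\mathbb R^m$, $\partial h(x)$ denotes the set of $n\times m$ matrices whose columns are subgradients of the components of $h$ at $x$. As functions of $T$: $h_1=O_+(h_2)$ means $h_1\le C h_2$, $h_1=O(h_2)$ means $|h_1|\le C h_2$, and $h_1=\Omega(h_2)$ means $h_1\ge C h_2$, for some constant $C>0$ independent of $T$. Network. There are $N$ agents communicating over directed graphs $\mathcal G_t=(\mathcal V,\mathcal E_t)$, $\mathcal V=[N]$, with nonnegative adjacency matrices $A_t=(a_{ij,t})\in\mathbb R^{N\times N}$, where $a_{ij,t}>0$ if $(j,i)\in\mathcal E_t$ and $a_{ij,t}=0$ otherwise; every node is its own in- and out-neighbor. Assumptions, for all $t\ge0$: (N1) there is a constant $0<a<1$ with $a_{ij,t}\ge a$ whenever $a_{ij,t}>0$, and $a_{ii,t}\ge a$ for all $i$; (N2) $A_t$ is column-stochastic: $\sum_{i=1}^N a_{ij,t}=1$ for all $j\in[N]$; (N3) there is a constant (integer) $Q>0$ such that the graph $(\mathcal V,\cup_{l=0,\ldots,Q-1}\mathcal E_{t+l})$ is strongly connected for all $t\ge1$. Problem. For each $i\in[N]$, $X_i\subset\mathbb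 R^{n_i}$, $f_{i,t}:\mathbb R^{n_i}\to\mathbb R$ ($t\ge0$) and $g_i:\mathbb R^{n_i}\to\mathbb R^m$. Put $X=X_1\times\cdots\times X_N$, $g(x)=\sum_{i=1}^N g_i(x_i)$ for $x=col(x_1,\ldots,x_N)$, and $\mathcal X=\{x\in X: g(x)\le\mathbf 0\}$, assumed nonempty. Assumptions: (P1) all $f_{i,t}$ and (componentwise) $g_i$ are convex on $\mathbb R^{n_i}$; (P2) all $X_i$ are convex and compact; (P3) (Slater) there is $x_s$ in the relative interior of $X$ with $g(x_s)\le\mathbf 0$ for those components of $g$ that are linear in $x$, if any, and $g(x_s)<\mathbf 0$ for all other components; (P4) there are $B_f,C_f>0$ such that for all $t\ge0$, $i\in[N]$, $x,y\in X_i$: $|f_{i,t}(x)|\le B_f$, $|f_{i,t}(x)-f_{i,t}(y)|\le C_f\|x-y\|$, and every subgradient in $\partial f_{i,t}(x)$ has norm at most $C_f$. For each $t$ let $x_t^*=col(x_{1,t}^*,\ldots,x_{N,t}^* )\in\arg\min_{x\in\mathcal X}\sum_{i=1}^N f_{i,t}(x_i)$. Algorithm DOPP. Initialize $w_{i,0}=1$, $x_{i,0}\in X_i$, $\mu_{i,0}=\mathbf 0$, $y_{i,0}=g_i(x_{i,0})$. For $t=0,1,2,\ldots$ and each $i\in[N]$: $w_{i,t+1}=\sum_j a_{ij,t}w_{j,t}$, $\ \hat\mu_{i,t}=\sum_j a_{ij,t}\mu_{j,t}$, $\ \hat y_{i,t}=\sum_j a_{ij,t}y_{j,t}$, $s_{i,t+1}\in\partial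 f_{i,t}(x_{i,t})+\partial g_i(x_{i,t})\,\hat\mu_{i,t}/w_{i,t+1}$, $x_{i,t+1}=P_{X_i}(x_{i,t}-\alpha_t s_{i,t+1})$, $\mu_{i,t+1}=\big[\hat\mu_{i,t}+\alpha_t\big(\hat y_{i,t}/w_{i,t+1}-\beta_t\hat\mu_{i,t}\big)\big]_+$, $y_{i,t+1}=\hat y_{i,t}+g_i(x_{i,t+1})-g_i(x_{i,t})$. Performance measures. The dynamic regret and the constraint violation are $$Reg(T)=\sum_{t=1}^T\sum_{i=1}^N f_{i,t}(x_{i,t})-\sum_{t=1}^T\sum_{i=1}^N f_{i,t}(x_{i,t}^* ),\qquad Reg^c(T)=\Big\|\Big[\sum_{t=1}^T\sum_{i=1}^N g_i(x_{i,t})\Big]_+\Big\|.$$ *)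

theory Defs
  imports "HOL-Analysis.Analysis"
begin

text \<open>
  The agents are the elements of a finite type \<open>'n\<close>, and the constraint has \<open>CARD('m)\<close> components.
  The decision spaces of the agents may have different dimensions. Since a family of types is not
  available, the space of agent \<open>i\<close> is the coordinate subspace of \<open>real ^ 'd\<close> spanned by the coordinates in
  a set \<open>D i\<close>, so that its dimension is \<open>card (D i)\<close>. Any family of dimensions is obtained by taking
  \<open>CARD('d)\<close> large enough. Convexity and subgradients are relative to this subspace.
  Stacked vectors have type \<open>real ^ 'd ^ 'n\<close>, with Euclidean norm and topology.
\<close>

definition coord_space :: "'d::finite set \<Rightarrow> (real ^ 'd) set" where
  "coord_space D = {v. \<forall>k. k \<notin> D \<longrightarrow> v $ k = 0}"

definition stack_set :: "('n::finite \<Rightarrow> 'a set) \<Rightarrow> ('a ^ 'n) set" where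
  "stack_set X = {x. \<forall>i. x $ i \<in> X i}"

definition subdiff :: "'a::real_inner set \<Rightarrow> ('a \<Rightarrow> real) \<Rightarrow> 'a \<Rightarrow> 'a set" where
  "subdiff V h x = {s \<in> V. \<forall>z\<in>V. h z \<ge> h x + s \<bullet> (z - x)}"

definition subdiff_mat ::
  "(real ^ 'd::finite) set \<Rightarrow> (real ^ 'd \<Rightarrow> real ^ 'm::finite) \<Rightarrow> real ^ 'd \<Rightarrow> (real ^ 'm ^ 'd) set" where
  "subdiff_mat V h x = {G. \<forall>k. column k G \<in> subdiff V (\<lambda>z. h z $ k) x}"

definition pos_part :: "real ^ 'm::finite \<Rightarrow> real ^ 'm" where
  "pos_part z = (\<chi> k. max 0 (z $ k))"

definition strongly_connected :: "('n \<times> 'n) set \<Rightarrow> bool" where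
  "strongly_connected E \<longleftrightarrow> (\<forall>u v. (u, v) \<in> E\<^sup>*)"

text \<open>An edge \<open>(j, i)\<close> goes from \<open>j\<close> to \<open>i\<close>, and \<open>A t $ i $ j\<close> is its weight at time \<open>t\<close>.\<close>

definition adjacency_of :: "(nat \<Rightarrow> real ^ 'n::finite ^ 'n) \<Rightarrow> (nat \<Rightarrow> ('n \<times> 'n) set) \<Rightarrow> bool" where
  "adjacency_of A E \<longleftrightarrow>
     (\<forall>t i. (i, i) \<in> E t) \<and>
     (\<forall>t i j. ((j, i) \<in> E t \<longrightarrow> A t $ i $ j > 0) \<and> ((j, i) \<notin> E t \<longrightarrow> A t $ i $ j = 0))"

definition total_g :: "('n::finite \<Rightarrow> 'a \<Rightarrow> real ^ 'm::finite) \<Rightarrow> 'a ^ 'n \<Rightarrow> real ^ 'm" where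
  "total_g g x = (\<Sum>i\<in>UNIV. g i (x $ i))"

definition total_f :: "('n::finite \<Rightarrow> nat \<Rightarrow> 'a \<Rightarrow> real) \<Rightarrow> nat \<Rightarrow> 'a ^ 'n \<Rightarrow> real" where
  "total_f f t x = (\<Sum>i\<in>UNIV. f i t (x $ i))"

definition feasible_set ::
  "('n::finite \<Rightarrow> 'a set) \<Rightarrow> ('n \<Rightarrow> 'a \<Rightarrow> real ^ 'm::finite) \<Rightarrow> ('a ^ 'n) set" where
  "feasible_set X g = {x \<in> stack_set X. \<forall>k. total_g g x $ k \<le> 0}"

text \<open>As usual in constraint qualifications, linear components may have a constant term.\<close>

definition linear_component ::
  "('n::finite \<Rightarrow> 'd::finite set) \<Rightarrow> ('n \<Rightarrow> real ^ 'd \<Rightarrow> real ^ 'm::finite) \<Rightarrow> 'm \<Rightarrow> bool" where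
  "linear_component D g k \<longleftrightarrow>
     (\<exists>c b. \<forall>x \<in> stack_set (\<lambda>i. coord_space (D i)). total_g g x $ k = c \<bullet> x + b)"

definition slater ::
  "('n::finite \<Rightarrow> 'd::finite set) \<Rightarrow> ('n \<Rightarrow> (real ^ 'd) set) \<Rightarrow>
   ('n \<Rightarrow> real ^ 'd \<Rightarrow> real ^ 'm::finite) \<Rightarrow> bool" where
  "slater D X g \<longleftrightarrow>
     (\<exists>xs \<in> rel_interior (stack_set X).
        \<forall>k. if linear_component D g k then total_g g xs $ k \<le> 0 else total_g g xs $ k < 0)"

definition mix :: "real ^ 'n::finite ^ 'n \<Rightarrow> ('b::real_vector) ^ 'n \<Rightarrow> 'b ^ 'n" where
  "mix A v = (\<chi> i. \<Sum>j\<in>UNIV. (A $ i $ j) *\<^sub>R (v $ j))"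

text \<open>
  The predicate says that \<open>x, w, \<mu>, y, s\<close> is a run of DOPP. It does not determine the run, because the
  initial decisions and the subgradients are free choices.
\<close>

definition dopp_run ::
  "(nat \<Rightarrow> real ^ 'n::finite ^ 'n) \<Rightarrow> ('n \<Rightarrow> 'd::finite set) \<Rightarrow> ('n \<Rightarrow> (real ^ 'd) set) \<Rightarrow>
   ('n \<Rightarrow> nat \<Rightarrow> real ^ 'd \<Rightarrow> real) \<Rightarrow> ('n \<Rightarrow> real ^ 'd \<Rightarrow> real ^ 'm::finite) \<Rightarrow>
   (nat \<Rightarrow> real) \<Rightarrow> (nat \<Rightarrow> real) \<Rightarrow>
   (nat \<Rightarrow> real ^ 'd ^ 'n) \<Rightarrow> (nat \<Rightarrow> real ^ 'n) \<Rightarrow> (nat \<Rightarrow> real ^ 'm ^ 'n) \<Rightarrow>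
   (nat \<Rightarrow> real ^ 'm ^ 'n) \<Rightarrow> (nat \<Rightarrow> real ^ 'd ^ 'n) \<Rightarrow> bool" where
  "dopp_run A D X f g \<alpha> \<beta> x w \<mu> y s \<longleftrightarrow>
     (\<forall>i. w 0 $ i = 1 \<and> x 0 $ i \<in> X i \<and> \<mu> 0 $ i = 0 \<and> y 0 $ i = g i (x 0 $ i)) \<and>
     (\<forall>t i.
        let V = coord_space (D i);
            w' = w (Suc t) $ i;
            \<mu>h = mix (A t) (\<mu> t) $ i;
            yh = mix (A t) (y t) $ i
        in w' = mix (A t) (w t) $ i \<and>
           (\<exists>u \<in> subdiff V (f i t) (x t $ i). \<exists>G \<in> subdiff_mat V (g i) (x t $ i).
              s (Suc t) $ i = u + G *v (\<mu>h /\<^sub>R w')) \<and>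
           x (Suc t) $ i = closest_point (X i) (x t $ i - \<alpha> t *\<^sub>R s (Suc t) $ i) \<and>
           \<mu> (Suc t) $ i = pos_part (\<mu>h + \<alpha> t *\<^sub>R (yh /\<^sub>R w' - \<beta> t *\<^sub>R \<mu>h)) \<and>
           y (Suc t) $ i = yh + g i (x (Suc t) $ i) - g i (x t $ i))"

definition Reg ::
  "('n::finite \<Rightarrow> nat \<Rightarrow> 'a \<Rightarrow> real) \<Rightarrow> (nat \<Rightarrow> 'a ^ 'n) \<Rightarrow> (nat \<Rightarrow> 'a ^ 'n) \<Rightarrow> nat \<Rightarrow> real" where
  "Reg f x xstar T = (\<Sum>t=1..T. total_f f t (x t)) - (\<Sum>t=1..T. total_f f t (xstar t))"

definition Reg_c ::
  "('n::finite \<Rightarrow> 'a \<Rightarrow> real ^ 'm::finite) \<Rightarrow> (nat \<Rightarrow> 'a ^ 'n) \<Rightarrow> nat \<Rightarrow> real" where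
  "Reg_c g x T = norm (pos_part (\<Sum>t=1..T. total_g g (x t)))"

definition path_variation ::
  "(nat \<Rightarrow> real) \<Rightarrow> (nat \<Rightarrow> ('a::real_normed_vector) ^ 'n::finite) \<Rightarrow> nat \<Rightarrow> real" where
  "path_variation \<alpha> xstar T =
     (\<Sum>t=1..T. 1 / \<alpha> t * (\<Sum>i\<in>UNIV. norm (xstar (t + 1) $ i - xstar t $ i)))"

end

theory Submission
  imports Defs
begin

text \<open>
  Column stochasticity and connectivity make the push-sum ratios \<open>(A h)\<^sub>i / w\<^sub>i\<close> reach consensus
  geometrically, so the consensus errors of \<open>\<mu>\<close> and \<open>y\<close>, summed over time, are of the order of the summed
  increments. The multipliers satisfy \<open>\<mu>\<^sub>i \<le> (B / \<beta>\<^sub>t) w\<^sub>i\<close>. The squared distance to a comparator in the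
  primal variable and the weighted distance \<open>\<Sum>\<^sub>i |\<mu>\<^sub>i - w\<^sub>i p|\<^sup>2 / w\<^sub>i\<close> in the dual variable, the latter not increased by
  mixing, give for all feasible comparators \<open>z\<^sub>t\<close> and all \<open>p \<ge> 0\<close>
  \<open>\<Sum>\<^sub>t (F\<^sub>t(x\<^sub>t) - F\<^sub>t(z\<^sub>t)) + p \<bullet> \<Sum>\<^sub>t G(x\<^sub>t) \<le> K V\<^sub>T(z) + K T\<^bsup>1/2+2\<kappa>\<^esup> + K T\<^bsup>1-\<kappa>\<^esup> |p|\<^sup>2\<close>.
  The regret bound is the case \<open>p = 0\<close>; the violation bound follows by optimizing over \<open>p\<close> with a constant
  comparator. If all constraints are violated at some point of \<open>X\<close>, the Slater point can be made strict in all
  components, and then the suboptimality gap of an infeasible point is linear in its violation.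
\<close>

section \<open>Push-sum consensus\<close>

text \<open>Mixing preserves totals but not constant vectors, since only column sums are 1. The
  image \<open>w\<close> of the all-one vector is therefore the yardstick, and \<open>w p\<close>,
  not \<open>p\<close>, is the dual comparator. The obstacle is a circle: step lengths depend on the
  multipliers, the multipliers on the tracked constraint values \<open>Y\<close>, and the accuracy
  of \<open>Y\<close> on the step lengths. It is broken by first bounding \<open>Y\<close> crudely
  through compactness; the regularization then confines the multipliers to order 1/\<beta>, and only
  then do steps have length of order \<alpha>/\<beta> and consensus errors a rate. The exponents
  come from here: squared multipliers and squared subgradients are of order 1/\<beta>^2, and
  multiplied by 1/\<alpha>, or summed against \<alpha>, they cost T^(1/2+2\<kappa>). The
  regularization costs |p|^2 times the sum of \<beta>, of order T^(1-\<kappa>). In the violation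
  bound the regret is only known to be at least of order -T, so the squared violation is of order T
  times T^(1-\<kappa>).\<close>

lemma mix_nth: "mix A v $ i = (\<Sum>j\<in>UNIV. (A $ i $ j) *\<^sub>R (v $ j))"
  by (simp add: mix_def)

lemma mix_add: "mix A (u + v) = mix A u + mix A v"
  by (simp add: vec_eq_iff mix_nth scaleR_add_right sum.distrib)

lemma mix_diff: "mix A (u - v) = mix A u - mix A v"
  by (simp add: vec_eq_iff mix_nth scaleR_diff_right sum_subtractf)

lemma mix_scaleR: "mix A (c *\<^sub>R v) = c *\<^sub>R mix A v"
  by (simp add: vec_eq_iff mix_nth scaleR_sum_right mult.commute)

lemma mix_sum: "mix A (\<Sum>k\<in>S. v k) = (\<Sum>k\<in>S. mix A (v k))"
proof (induction S rule: infinite_finite_induct)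
  case (insert k S)
  then show ?case by (simp add: mix_add)
qed (auto simp: vec_eq_iff mix_nth)

text \<open>The product of the mixing matrices of times \<open>s\<close> to
  \<open>s + n - 1\<close>. It is polymorphic because it acts on scalar weights, on multipliers and
  on tracked constraint values alike.\<close>

primrec mix_iter ::
  "(nat \<Rightarrow> real ^ 'n::finite ^ 'n) \<Rightarrow> nat \<Rightarrow> nat \<Rightarrow> ('b::real_vector) ^ 'n \<Rightarrow> 'b ^ 'n" where
  "mix_iter A s 0 v = v"
| "mix_iter A s (Suc n) v = mix (A (s + n)) (mix_iter A s n v)"

lemma mix_iter_Suc_left: "mix_iter A s (Suc n) v = mix_iter A (Suc s) n (mix (A s) v)"
  by (induction n) auto

lemma mix_iter_add_steps: "mix_iter A s (m + n) v = mix_iter A (s + m) n (mix_iter A s m v)"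
  by (induction n) (auto simp: add.assoc)

lemma mix_iter_diff: "mix_iter A s n (u - v) = mix_iter A s n u - mix_iter A s n v"
  by (induction n) (auto simp: mix_diff)

lemma mix_iter_scaleR: "mix_iter A s n (c *\<^sub>R v) = c *\<^sub>R mix_iter A s n v"
  by (induction n) (auto simp: mix_scaleR)

text \<open>By linearity the images of the unit vectors determine the product, so decay only has to
  be proved for scalar entries.\<close>

lemma mix_iter_kernel:
  "mix_iter A s n v $ i = (\<Sum>j\<in>UNIV. (mix_iter A s n (axis j 1) $ i) *\<^sub>R (v $ j))"
proof (induction n arbitrary: i)
  case 0
  have "(\<Sum>j\<in>UNIV. (axis j (1::real) $ i) *\<^sub>R (v $ j)) = (\<Sum>j\<in>UNIV. if j = i then v $ j else 0)"
    by (intro sum.cong) (auto simp: axis_def)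
  then show ?case by simp
next
  case (Suc n)
  have "mix_iter A s (Suc n) v $ i =
      (\<Sum>l\<in>UNIV. \<Sum>j\<in>UNIV. (A (s + n) $ i $ l * mix_iter A s n (axis j 1) $ l) *\<^sub>R (v $ j))"
    by (simp add: mix_nth scaleR_sum_right Suc)
  also have "\<dots> = (\<Sum>j\<in>UNIV. \<Sum>l\<in>UNIV. (A (s + n) $ i $ l * mix_iter A s n (axis j 1) $ l) *\<^sub>R (v $ j))"
    by (rule sum.swap)
  also have "\<dots> = (\<Sum>j\<in>UNIV. (mix_iter A s (Suc n) (axis j 1) $ i) *\<^sub>R (v $ j))"
    by (simp add: mix_nth scaleR_sum_left)
  finally show ?case .
qed

lemma strongly_connected_leaves:
  assumes "strongly_connected E" "S \<noteq> {}" "S \<noteq> UNIV"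
  obtains u v where "(u, v) \<in> E" "u \<in> S" "v \<notin> S"
proof -
  obtain p q where "p \<in> S" "q \<notin> S" using assms by auto
  have "(p, q) \<in> E\<^sup>*" using assms(1) by (auto simp: strongly_connected_def)
  then have "\<exists>u v. (u, v) \<in> E \<and> u \<in> S \<and> v \<notin> S"
    using \<open>q \<notin> S\<close>
  proof (induction rule: rtrancl_induct)
    case base
    then show ?case using \<open>p \<in> S\<close> by simp
  qed blast
  then show thesis using that by blast
qed

locale push_sum =
  fixes A :: "nat \<Rightarrow> real ^ 'n::finite ^ 'n"
    and E :: "nat \<Rightarrow> ('n \<times> 'n) set"
    and a :: real and Q :: nat
    and w :: "nat \<Rightarrow> real ^ 'n"
    and n_agents :: real and period :: nat and \<eta> :: real
  defines n_agents_def: "n_agents \<equiv> real CARD('n)"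
    and period_def: "period \<equiv> CARD('n) * Q + 1"
    and \<eta>_def: "\<eta> \<equiv> a ^ period * a ^ period / n_agents"
  assumes graph: "adjacency_of A E"
    and a_pos: "0 < a" and a_less_1: "a < 1"
    and edge_weight: "\<And>t i j. A t $ i $ j > 0 \<Longrightarrow> A t $ i $ j \<ge> a"
    and diag_weight: "\<And>t i. A t $ i $ i \<ge> a"
    and column_stochastic: "\<And>t j. (\<Sum>i\<in>UNIV. A t $ i $ j) = 1"
    and Q_pos: "Q > 0"
    and connected: "\<And>t. t \<ge> 1 \<Longrightarrow> strongly_connected (\<Union>l\<in>{0..Q-1}. E (t + l))"
    and w_0: "\<And>i. w 0 $ i = 1"
    and w_Suc: "\<And>t. w (Suc t) = mix (A t) (w t)"
begin

section \<open>Conservation and spreading of mass\<close>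

lemma n_agents_ge_1: "n_agents \<ge> 1"
  using zero_less_card_finite[where 'a='n] unfolding n_agents_def by linarith

lemma A_nonneg: "A t $ i $ j \<ge> 0"
  using graph unfolding adjacency_of_def by (metis less_eq_real_def)

lemma mix_nonneg:
  assumes "\<And>j. (v::real^'n) $ j \<ge> 0"
  shows "mix (A t) v $ i \<ge> 0"
  by (auto simp: mix_nth intro!: sum_nonneg mult_nonneg_nonneg A_nonneg assms)

lemma mix_mono:
  assumes "\<And>j. (u::real^'n) $ j \<le> v $ j"
  shows "mix (A t) u $ i \<le> mix (A t) v $ i"
  by (auto simp: mix_nth intro!: sum_mono mult_left_mono A_nonneg assms)

lemma sum_mix: "(\<Sum>i\<in>UNIV. mix (A t) v $ i) = (\<Sum>i\<in>UNIV. v $ i)"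
proof -
  have "(\<Sum>i\<in>UNIV. mix (A t) v $ i) = (\<Sum>j\<in>UNIV. \<Sum>i\<in>UNIV. (A t $ i $ j) *\<^sub>R (v $ j))"
    unfolding mix_nth by (rule sum.swap)
  also have "\<dots> = (\<Sum>j\<in>UNIV. v $ j)"
    by (simp add: scaleR_sum_left[symmetric] column_stochastic)
  finally show ?thesis .
qed

lemma mix_edge_ge:
  assumes "\<And>j. (v::real^'n) $ j \<ge> 0" "(u, i) \<in> E t"
  shows "mix (A t) v $ i \<ge> a * v $ u"
proof -
  have "A t $ i $ u \<ge> a" using graph edge_weight assms(2) by (auto simp: adjacency_of_def)
  then have "a * v $ u \<le> A t $ i $ u * v $ u" by (intro mult_right_mono assms)
  also have "\<dots> \<le> mix (A t) v $ i"
    unfolding mix_nth real_scaleR_def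
    by (rule member_le_sum) (auto intro!: mult_nonneg_nonneg A_nonneg assms)
  finally show ?thesis .
qed

lemma self_loop: "(i, i) \<in> E t"
  using graph by (auto simp: adjacency_of_def)

lemma mix_iter_nonneg:
  assumes "\<And>j. (v::real^'n) $ j \<ge> 0"
  shows "mix_iter A s n v $ i \<ge> 0"
  by (induction n arbitrary: i) (auto simp: assms mix_nonneg)

lemma sum_mix_iter: "(\<Sum>i\<in>UNIV. mix_iter A s n v $ i) = (\<Sum>i\<in>UNIV. v $ i)"
  by (induction n) (auto simp: sum_mix)

text \<open>Mass from \<open>j\<close> spreads like an epidemic: self-loops keep reached agents
  reached, retaining at least a factor \<open>a\<close> per step, and in every window of
  \<open>Q\<close> steps some edge leaves the set of reached agents unless that set is
  everything.\<close>

lemma mix_iter_spread: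
  assumes v: "\<And>j. (v::real^'n) $ j \<ge> 0" and s: "s \<ge> 1"
  shows "mix_iter A s (CARD('n) * Q) v $ i \<ge> a ^ (CARD('n) * Q) * v $ j"
proof -
  define S where "S n = {i. mix_iter A s n v $ i \<ge> a ^ n * v $ j}" for n
  have edge: "l \<in> S (Suc n)" if "u \<in> S n" "(u, l) \<in> E (s + n)" for u l n
  proof -
    have "a ^ Suc n * v $ j \<le> a * mix_iter A s n v $ u"
      using that a_pos by (auto simp: S_def)
    also have "\<dots> \<le> mix_iter A s (Suc n) v $ l"
      using mix_edge_ge[OF mix_iter_nonneg[OF v] that(2)] by simp
    finally show ?thesis by (simp add: S_def)
  qed
  have mono: "S n \<subseteq> S (n + k)" for n k
    by (induction k) (use edge self_loop in \<open>fastforce+\<close>)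
  have grow: "S (k * Q) = UNIV \<or> card (S (k * Q)) \<ge> k + 1" for k
  proof (induction k)
    case 0
    have "j \<in> S 0" by (simp add: S_def)
    then show ?case using card_gt_0_iff[of "S 0"] by auto
  next
    case (Suc k)
    show ?case
    proof (cases "S (k * Q) = UNIV")
      case True
      then show ?thesis using mono[of "k * Q" Q] by (auto simp: add.commute)
    next
      case False
      then have card: "card (S (k * Q)) \<ge> k + 1" using Suc by auto
      then have "S (k * Q) \<noteq> {}" by auto
      moreover have "strongly_connected (\<Union>l\<in>{0..Q-1}. E ((s + k * Q) + l))"
        using s by (intro connected) auto
      ultimately obtain u v' where uv: "(u, v') \<in> (\<Union>l\<in>{0..Q-1}. E ((s + k * Q) + l))"
          "u \<in> S (k * Q)" "v' \<notin> S (k * Q)"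
        using False strongly_connected_leaves by metis
      then obtain l where l: "l \<le> Q - 1" "(u, v') \<in> E (s + (k * Q + l))" by (auto simp: add.assoc)
      have "u \<in> S (k * Q + l)" using mono uv(2) by blast
      then have "v' \<in> S (Suc (k * Q + l))" using edge l(2) by blast
      \<comment> \<open>The new agent is reached somewhere inside the window; self-loops carry it to
        the end.\<close>
      moreover have "Suc (k * Q + l) + (Q - 1 - l) = Suc k * Q" using l(1) Q_pos by simp
      ultimately have "v' \<in> S (Suc k * Q)" using mono by (metis subsetD)
      moreover have "S (k * Q) \<subseteq> S (Suc k * Q)" using mono[of "k * Q" Q] by (simp add: add.commute)
      ultimately have "insert v' (S (k * Q)) \<subseteq> S (Suc k * Q)" by auto
      then have "card (insert v' (S (k * Q))) \<le> card (S (Suc k * Q))" by (rule card_mono[OF finite])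
      then show ?thesis using uv(3) card by simp
    qed
  qed
  \<comment> \<open>For \<open>k = CARD('n)\<close> the second alternative of \<open>grow\<close>
    would require more agents than there are.\<close>
  have "card (S (CARD('n) * Q)) \<le> CARD('n)" by (rule card_mono) auto
  then have "S (CARD('n) * Q) = UNIV" using grow[of "CARD('n)"] by auto
  then show ?thesis by (auto simp: S_def)
qed

text \<open>The extra step makes the bound valid from time 0 on, where \<open>connected\<close> says nothing.\<close>

lemma mix_iter_period:
  assumes v: "\<And>j. (v::real^'n) $ j \<ge> 0"
  shows "mix_iter A s period v $ i \<ge> a ^ period * v $ j"
proof -
  have "a ^ period * v $ j \<le> a ^ (CARD('n) * Q) * mix (A s) v $ j"
    using mix_edge_ge[OF v self_loop, of j s] a_pos by (simp add: period_def)
  also have "\<dots> \<le> mix_iter A (Suc s) (CARD('n) * Q) (mix (A s) v) $ i"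
    by (rule mix_iter_spread) (auto intro: mix_nonneg v)
  finally show ?thesis by (simp add: period_def mix_iter_Suc_left del: mix_iter.simps)
qed

section \<open>Bounds on the push-sum weights\<close>

lemma w_mix_iter: "w (s + n) = mix_iter A s n (w s)"
  by (induction n) (auto simp: w_Suc)

lemma w_nonneg: "w t $ i \<ge> 0"
  using mix_iter_nonneg[of "w 0" 0 t i] by (simp add: w_mix_iter[of 0 t, simplified] w_0)

lemma sum_w: "(\<Sum>i\<in>UNIV. w t $ i) = n_agents"
  using sum_mix_iter[of 0 t "w 0"] by (simp add: n_agents_def w_mix_iter[of 0 t, simplified] w_0)

lemma w_le: "w t $ i \<le> n_agents"
  unfolding sum_w[of t, symmetric] by (rule member_le_sum) (auto intro: w_nonneg)

text \<open>Before one period has passed, self-loops alone preserve enough of the initial weight 1.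
  Later, conservation of the total yields an agent whose weight one period earlier was at least the
  average 1, and it passes a share to everyone.\<close>

lemma w_ge: "w t $ i \<ge> a ^ period"
proof (cases "t < period")
  case True
  have "w t $ i \<ge> a ^ t"
  proof (induction t)
    case 0
    then show ?case by (simp add: w_0)
  next
    case (Suc t)
    have "a ^ Suc t \<le> a * w t $ i" using Suc a_pos by simp
    also have "\<dots> \<le> w (Suc t) $ i" unfolding w_Suc by (rule mix_edge_ge) (auto intro: w_nonneg self_loop)
    finally show ?case .
  qed
  moreover have "a ^ period \<le> a ^ t" using True a_pos a_less_1 by (intro power_decreasing) auto
  ultimately show ?thesis by simp
next
  case False
  define s where "s = t - period"
  have t: "t = s + period" using False by (simp add: s_def)
  have "\<exists>j. w s $ j \<ge> 1"
  proof (rule ccontr)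
    assume "\<not> ?thesis"
    then have "(\<Sum>j\<in>UNIV. w s $ j) < (\<Sum>j\<in>(UNIV::'n set). 1)"
      by (intro sum_strict_mono) (auto simp: not_le)
    then show False by (simp add: sum_w n_agents_def)
  qed
  then obtain j where j: "w s $ j \<ge> 1" by auto
  have "a ^ period * 1 \<le> a ^ period * w s $ j" using j a_pos by (intro mult_left_mono) auto
  also have "\<dots> \<le> w t $ i" unfolding t w_mix_iter by (rule mix_iter_period) (rule w_nonneg)
  finally show ?thesis by simp
qed

lemma w_pos: "w t $ i > 0"
  using w_ge[of t i] a_pos by (smt (verit) zero_less_power)

section \<open>Geometric consensus of the ratios\<close>

text \<open>Apply positivity of mixing to \<open>h - m w\<close> and \<open>M w - h\<close>: the
  ratios to \<open>w\<close> never leave an interval that contains them all.\<close>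

lemma mix_iter_between:
  assumes "\<And>i. m * w s $ i \<le> (h::real^'n) $ i" "\<And>i. h $ i \<le> M * w s $ i"
  shows "m * w (s + n) $ i \<le> mix_iter A s n h $ i" "mix_iter A s n h $ i \<le> M * w (s + n) $ i"
proof -
  have "mix_iter A s n (h - m *\<^sub>R w s) $ i \<ge> 0" "mix_iter A s n (M *\<^sub>R w s - h) $ i \<ge> 0"
    by (intro mix_iter_nonneg; use assms in simp)+
  then show "m * w (s + n) $ i \<le> mix_iter A s n h $ i" "mix_iter A s n h $ i \<le> M * w (s + n) $ i"
    by (auto simp: mix_iter_diff mix_iter_scaleR w_mix_iter)
qed

lemma eta: "0 < \<eta>" "\<eta> < 1"
proof -
  have "a ^ period < 1" using power_Suc_less_one[of a "CARD('n) * Q"] a_pos a_less_1 by (simp add: period_def)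
  moreover have p: "0 < a ^ period" using a_pos by simp
  ultimately have "a ^ period * a ^ period < 1 * 1" by (intro mult_strict_mono) auto
  then show "0 < \<eta>" "\<eta> < 1" using p n_agents_ge_1 by (auto simp: \<eta>_def divide_simps)
qed

text \<open>Compare with the ratio \<open>c\<close> of one agent: after a period, every agent has received a share of
  at least \<open>\<eta>\<close> from it, so both ends of the interval of ratios move towards \<open>c\<close>.\<close>

lemma spread_contraction:
  assumes "\<And>i. m * w s $ i \<le> (h::real^'n) $ i" "\<And>i. h $ i \<le> M * w s $ i"
  obtains m' M' where "M' - m' = (1 - \<eta>) * (M - m)"
    "\<And>i. m' * w (s + period) $ i \<le> mix_iter A s period h $ i"
    "\<And>i. mix_iter A s period h $ i \<le> M' * w (s + period) $ i"
proof -
  fix j :: 'n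
  define c where "c = h $ j / w s $ j"
  have c: "h $ j = c * w s $ j" using w_pos[of s j] by (simp add: c_def)
  have mc: "m \<le> c" "c \<le> M" using assms(1)[of j] assms(2)[of j] w_pos[of s j]
    by (auto simp: c)
  \<comment> \<open>Origin of \<open>\<eta>\<close>: one factor \<open>a ^ period\<close> is the
    share passed on, the other bounds the weight of \<open>j\<close> from below, and
    \<open>n_agents\<close> bounds the weight of the receiver from above.\<close>
  have share: "\<eta> * x * w (s + period) $ i \<le> a ^ period * (x * w s $ j)" if "x \<ge> 0" for x i
  proof -
    have "\<eta> * x * w (s + period) $ i \<le> \<eta> * x * n_agents"
      using that eta by (intro mult_left_mono w_le) auto
    also have "\<dots> = a ^ period * (x * a ^ period)" using n_agents_ge_1 by (simp add: \<eta>_def)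
    also have "\<dots> \<le> a ^ period * (x * w s $ j)"
      using that a_pos by (intro mult_left_mono w_ge) auto
    finally show ?thesis .
  qed
  have lower: "(m + \<eta> * (c - m)) * w (s + period) $ i \<le> mix_iter A s period h $ i" for i
  proof -
    have "\<eta> * (c - m) * w (s + period) $ i \<le> a ^ period * (h - m *\<^sub>R w s) $ j"
      using share[of "c - m" i] mc by (simp add: c algebra_simps)
    also have "\<dots> \<le> mix_iter A s period (h - m *\<^sub>R w s) $ i"
      by (rule mix_iter_period) (use assms in simp)
    finally show ?thesis by (simp add: mix_iter_diff mix_iter_scaleR w_mix_iter[symmetric] algebra_simps)
  qed
  have upper: "mix_iter A s period h $ i \<le> (M - \<eta> * (M - c)) * w (s + period) $ i" for i
  proof -
    have "\<eta> * (M - c) * w (s + period) $ i \<le> a ^ period * (M *\<^sub>R w s - h) $ j"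
      using share[of "M - c" i] mc by (simp add: c algebra_simps)
    also have "\<dots> \<le> mix_iter A s period (M *\<^sub>R w s - h) $ i"
      by (rule mix_iter_period) (use assms in simp)
    finally show ?thesis by (simp add: mix_iter_diff mix_iter_scaleR w_mix_iter[symmetric] algebra_simps)
  qed
  show thesis
    by (rule that[of "M - \<eta> * (M - c)" "m + \<eta> * (c - m)"]) (use lower upper in \<open>simp_all add: left_diff_distrib right_diff_distrib\<close>)
qed

lemma spread_decay:
  assumes "\<And>i. m * w s $ i \<le> (h::real^'n) $ i" "\<And>i. h $ i \<le> M * w s $ i"
  shows "\<exists>m' M'. M' - m' = (1 - \<eta>) ^ k * (M - m) \<and>
    (\<forall>i. m' * w (s + k * period) $ i \<le> mix_iter A s (k * period) h $ i) \<and>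
    (\<forall>i. mix_iter A s (k * period) h $ i \<le> M' * w (s + k * period) $ i)"
proof (induction k)
  case 0
  then show ?case using assms by auto
next
  case (Suc k)
  then obtain m1 M1 where 1: "M1 - m1 = (1 - \<eta>) ^ k * (M - m)"
    "\<And>i. m1 * w (s + k * period) $ i \<le> mix_iter A s (k * period) h $ i"
    "\<And>i. mix_iter A s (k * period) h $ i \<le> M1 * w (s + k * period) $ i" by blast
  obtain m2 M2 where 2: "M2 - m2 = (1 - \<eta>) * (M1 - m1)"
    "\<And>i. m2 * w (s + k * period + period) $ i \<le> mix_iter A (s + k * period) period (mix_iter A s (k * period) h) $ i"
    "\<And>i. mix_iter A (s + k * period) period (mix_iter A s (k * period) h) $ i \<le> M2 * w (s + k * period + period) $ i"
    by (rule spread_contraction[OF 1(2,3)]) blast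
  have t: "s + k * period + period = s + Suc k * period" "k * period + period = Suc k * period" by simp_all
  have h: "mix_iter A (s + k * period) period (mix_iter A s (k * period) h) = mix_iter A s (Suc k * period) h"
    by (rule mix_iter_add_steps[of A s "k * period" period h, unfolded t(2), symmetric])
  have "M2 - m2 = (1 - \<eta>) ^ Suc k * (M - m)" using 2(1) 1(1) by simp
  then show ?case using 2(2,3) unfolding t(1) h by blast
qed

lemma kernel_consensus:
  obtains C \<rho> where "C > 0" "0 < \<rho>" "\<rho> < 1"
    "\<And>s n i j. \<bar>mix_iter A s n (axis j 1) $ i / w (s + n) $ i - 1 / n_agents\<bar> \<le> C * \<rho> ^ n"
proof -
  \<comment> \<open>A whole period contracts by \<open>1 - \<eta>\<close>; the root distributes this
    over single steps.\<close>
  define \<rho> where "\<rho> = root period (1 - \<eta>)"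
  have P: "period > 0" by (simp add: period_def)
  have lam: "0 < \<rho>" "\<rho> < 1" "\<rho> ^ period = 1 - \<eta>"
    using P eta by (auto simp: \<rho>_def real_root_gt_0_iff)
  define M where "M = 1 / a ^ period"
  have M: "M > 0" using a_pos by (simp add: M_def)
  have "\<bar>mix_iter A s n (axis j 1) $ i / w (s + n) $ i - 1 / n_agents\<bar> \<le> (M / (1 - \<eta>)) * \<rho> ^ n" for s n i j
  proof -
    define h :: "real^'n" where "h = axis j 1"
    define k where "k = n div period"
    define q where "q = n mod period"
    have n: "n = k * period + q" by (simp add: k_def q_def)
    have h: "0 * w s $ i \<le> h $ i" "h $ i \<le> M * w s $ i" for i
      using w_ge[of s i] w_pos[of s i] a_pos M by (auto simp: h_def axis_def M_def divide_simps)
    obtain m1 M1 where 1: "M1 - m1 = (1 - \<eta>) ^ k * (M - 0)"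
      "\<And>i. m1 * w (s + k * period) $ i \<le> mix_iter A s (k * period) h $ i"
      "\<And>i. mix_iter A s (k * period) h $ i \<le> M1 * w (s + k * period) $ i"
      using spread_decay[OF h, of k] by blast
    note 2 = mix_iter_between[OF 1(2,3), of q]
    define H where "H = mix_iter A s n h"
    have H: "m1 * w (s + n) $ i \<le> H $ i" "H $ i \<le> M1 * w (s + n) $ i" for i
      using 2 unfolding H_def n mix_iter_add_steps by (auto simp: add.assoc)
    have sumH: "(\<Sum>i\<in>UNIV. H $ i) = 1"
      unfolding H_def sum_mix_iter by (simp add: h_def axis_def)
    \<comment> \<open>Totals identify the limit: \<open>H\<close> sums to 1 and \<open>w\<close> to
      \<open>n_agents\<close>, so the weighted mean \<open>1 / n_agents\<close> of the ratios lies
      between \<open>m1\<close> and \<open>M1\<close>.\<close>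
    have "m1 * n_agents \<le> 1" "1 \<le> M1 * n_agents"
      unfolding sumH[symmetric] sum_w[of "s + n", symmetric] sum_distrib_left
      by (intro sum_mono H)+
    then have "m1 \<le> 1 / n_agents" "1 / n_agents \<le> M1"
      using n_agents_ge_1 by (auto simp: divide_simps)
    moreover have "m1 \<le> H $ i / w (s + n) $ i" "H $ i / w (s + n) $ i \<le> M1"
      using H[of i] w_pos[of "s + n" i] by (auto simp: divide_simps)
    ultimately have "\<bar>H $ i / w (s + n) $ i - 1 / n_agents\<bar> \<le> M1 - m1" by linarith
    \<comment> \<open>The last, incomplete period has only \<open>q < period\<close> steps and no
      contraction of its own; the factor \<open>1 / (1 - \<eta>)\<close> pays for it.\<close>
    also have "\<dots> = (M / (1 - \<eta>)) * ((1 - \<eta>) ^ k * \<rho> ^ period)" using 1(1) lam eta by simp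
    also have "\<dots> \<le> (M / (1 - \<eta>)) * ((1 - \<eta>) ^ k * \<rho> ^ q)"
      using M eta lam P by (intro mult_left_mono power_decreasing) (auto simp: q_def less_imp_le)
    also have "\<dots> = (M / (1 - \<eta>)) * \<rho> ^ n"
      unfolding n lam(3)[symmetric] by (simp add: power_add mult.commute flip: power_mult)
    finally show ?thesis by (simp add: H_def h_def)
  qed
  then show thesis using that[of "M / (1 - \<eta>)" \<rho>] M eta lam by auto
qed

lemma mix_iter_consensus:
  obtains C \<rho> where "C > 0" "0 < \<rho>" "\<rho> < 1"
    "\<And>s n i (v :: ('b::real_normed_vector) ^ 'n).
       norm (mix_iter A s n v $ i /\<^sub>R w (s + n) $ i - (\<Sum>j\<in>UNIV. v $ j) /\<^sub>R n_agents)
         \<le> C * \<rho> ^ n * (\<Sum>j\<in>UNIV. norm (v $ j))"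
proof -
  obtain C \<rho> where C: "C > 0" "0 < \<rho>" "\<rho> < 1"
    "\<And>s n i j. \<bar>mix_iter A s n (axis j 1) $ i / w (s + n) $ i - 1 / n_agents\<bar> \<le> C * \<rho> ^ n"
    by (rule kernel_consensus) blast
  have "norm (mix_iter A s n v $ i /\<^sub>R w (s + n) $ i - (\<Sum>j\<in>UNIV. v $ j) /\<^sub>R n_agents)
         \<le> C * \<rho> ^ n * (\<Sum>j\<in>UNIV. norm (v $ j))" for s n i and v :: "'b ^ 'n"
  proof -
    have "mix_iter A s n v $ i /\<^sub>R w (s + n) $ i - (\<Sum>j\<in>UNIV. v $ j) /\<^sub>R n_agents =
       (\<Sum>j\<in>UNIV. (mix_iter A s n (axis j 1) $ i / w (s + n) $ i - 1 / n_agents) *\<^sub>R (v $ j))"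
      by (subst mix_iter_kernel)
        (simp add: scaleR_diff_left sum_subtractf scaleR_sum_right divide_inverse mult.commute)
    also have "norm \<dots> \<le> (\<Sum>j\<in>UNIV. \<bar>mix_iter A s n (axis j 1) $ i / w (s + n) $ i - 1 / n_agents\<bar> * norm (v $ j))"
      by (rule order.trans[OF norm_sum]) simp
    also have "\<dots> \<le> (\<Sum>j\<in>UNIV. C * \<rho> ^ n * norm (v $ j))"
      by (intro sum_mono mult_right_mono C(4)) auto
    finally show ?thesis by (simp add: sum_distrib_left)
  qed
  then show thesis using that C by blast
qed

text \<open>Discrete variation of constants: a perturbation made at time \<open>s\<close> is mixed
  from time \<open>Suc s\<close> on.\<close>

lemma perturbed_unroll:
  fixes h e :: "nat \<Rightarrow> ('b::real_normed_vector) ^ 'n"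
  assumes "\<And>t. h (Suc t) = mix (A t) (h t) + e t"
  shows "h t = mix_iter A 0 t (h 0) + (\<Sum>s<t. mix_iter A (Suc s) (t - Suc s) (e s))"
proof (induction t)
  case (Suc t)
  have "mix (A t) (mix_iter A (Suc s) (t - Suc s) (e s)) = mix_iter A (Suc s) (Suc t - Suc s) (e s)"
    if "s < t" for s
  proof -
    have "Suc t - Suc s = Suc (t - Suc s)" "Suc s + (t - Suc s) = t" using that by auto
    then show ?thesis by simp
  qed
  then have "mix (A t) (\<Sum>s<t. mix_iter A (Suc s) (t - Suc s) (e s)) =
      (\<Sum>s<t. mix_iter A (Suc s) (Suc t - Suc s) (e s))"
    unfolding mix_sum by (intro sum.cong) auto
  then show ?case by (subst assms, subst Suc) (simp add: mix_add add.assoc)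
qed simp

lemma perturbed_sum:
  fixes h e :: "nat \<Rightarrow> ('b::real_normed_vector) ^ 'n"
  assumes "\<And>t. h (Suc t) = mix (A t) (h t) + e t"
  shows "(\<Sum>i\<in>UNIV. h t $ i) = (\<Sum>i\<in>UNIV. h 0 $ i) + (\<Sum>s<t. \<Sum>i\<in>UNIV. e s $ i)"
  by (induction t) (auto simp: assms sum.distrib sum_mix add.assoc)

text \<open>Each summand of the unrolled recursion approaches its own average geometrically, and by
  conservation these averages add up to the average of \<open>h t\<close>.\<close>

lemma perturbed_consensus:
  obtains C \<rho> where "C > 0" "0 < \<rho>" "\<rho> < 1"
    "\<And>(h :: nat \<Rightarrow> ('b::real_normed_vector) ^ 'n) e t i.
       (\<And>t. h (Suc t) = mix (A t) (h t) + e t) \<Longrightarrow>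
       norm (mix (A t) (h t) $ i /\<^sub>R w (Suc t) $ i - (\<Sum>j\<in>UNIV. h t $ j) /\<^sub>R n_agents)
         \<le> C * (\<rho> ^ t * (\<Sum>j\<in>UNIV. norm (h 0 $ j)) + (\<Sum>s<t. \<rho> ^ (t - Suc s) * (\<Sum>j\<in>UNIV. norm (e s $ j))))"
proof -
  obtain C \<rho> where C: "C > 0" "0 < \<rho>" "\<rho> < 1"
    "\<And>s n i (v :: 'b ^ 'n).
       norm (mix_iter A s n v $ i /\<^sub>R w (s + n) $ i - (\<Sum>j\<in>UNIV. v $ j) /\<^sub>R n_agents)
         \<le> C * \<rho> ^ n * (\<Sum>j\<in>UNIV. norm (v $ j))"
    by (rule mix_iter_consensus) blast
  have "norm (mix (A t) (h t) $ i /\<^sub>R w (Suc t) $ i - (\<Sum>j\<in>UNIV. h t $ j) /\<^sub>R n_agents)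
         \<le> C * (\<rho> ^ t * (\<Sum>j\<in>UNIV. norm (h 0 $ j)) + (\<Sum>s<t. \<rho> ^ (t - Suc s) * (\<Sum>j\<in>UNIV. norm (e s $ j))))"
    if h: "\<And>t. h (Suc t) = mix (A t) (h t) + e t" for h e :: "nat \<Rightarrow> 'b ^ 'n" and t i
  proof -
    define \<delta> where "\<delta> s n v = mix_iter A s n v $ i /\<^sub>R w (s + n) $ i - (\<Sum>j\<in>UNIV. v $ j) /\<^sub>R n_agents"
      for s n and v :: "'b ^ 'n"
    \<comment> \<open>The ratio is taken after one further mixing step. The factor
      \<open>\<rho>\<close> gained by it is given away.\<close>
    have step: "norm (\<delta> s (Suc n) v) \<le> C * (\<rho> ^ n * (\<Sum>j\<in>UNIV. norm (v $ j)))" for s n v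
    proof -
      have "norm (\<delta> s (Suc n) v) \<le> C * \<rho> ^ Suc n * (\<Sum>j\<in>UNIV. norm (v $ j))" unfolding \<delta>_def by (rule C)
      also have "\<dots> \<le> C * \<rho> ^ n * (\<Sum>j\<in>UNIV. norm (v $ j))"
        using C by (intro mult_right_mono mult_left_mono power_decreasing sum_nonneg) auto
      finally show ?thesis by (simp add: mult.assoc)
    qed
    have *: "mix (A t) (mix_iter A (Suc s) (t - Suc s) (e s)) = mix_iter A (Suc s) (Suc (t - Suc s)) (e s)
      \<and> Suc s + Suc (t - Suc s) = Suc t" if "s < t" for s
      using that by simp
    have "mix (A t) (h t) = mix_iter A 0 (Suc t) (h 0) + (\<Sum>s<t. mix_iter A (Suc s) (Suc (t - Suc s)) (e s))"
      by (subst perturbed_unroll[OF h, of t]) (auto simp: mix_add mix_sum)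
    then have "mix (A t) (h t) $ i /\<^sub>R w (Suc t) $ i - (\<Sum>j\<in>UNIV. h t $ j) /\<^sub>R n_agents =
        \<delta> 0 (Suc t) (h 0) + (\<Sum>s<t. mix_iter A (Suc s) (Suc (t - Suc s)) (e s) $ i /\<^sub>R w (Suc t) $ i
           - (\<Sum>j\<in>UNIV. e s $ j) /\<^sub>R n_agents)"
      unfolding \<delta>_def perturbed_sum[OF h, of t]
      by (simp add: scaleR_add_right scaleR_sum_right sum_subtractf sum_component del: mix_iter.simps)
    also have "\<dots> = \<delta> 0 (Suc t) (h 0) + (\<Sum>s<t. \<delta> (Suc s) (Suc (t - Suc s)) (e s))"
      unfolding \<delta>_def using * by (intro arg_cong2[of _ _ _ _ "(+)"] sum.cong) auto
    also have "norm \<dots> \<le> norm (\<delta> 0 (Suc t) (h 0)) + (\<Sum>s<t. norm (\<delta> (Suc s) (Suc (t - Suc s)) (e s)))"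
      by (rule norm_triangle_mono) (auto intro: norm_sum)
    also have "\<dots> \<le> C * (\<rho> ^ t * (\<Sum>j\<in>UNIV. norm (h 0 $ j)))
        + (\<Sum>s<t. C * (\<rho> ^ (t - Suc s) * (\<Sum>j\<in>UNIV. norm (e s $ j))))"
      by (intro add_mono sum_mono step)
    finally show ?thesis by (simp add: sum_distrib_left distrib_left)
  qed
  then show thesis using that C by blast
qed

text \<open>The perspective |d|^2 / w is jointly convex and positively homogeneous, hence
  subadditive, and since columns sum to 1 each sender is counted exactly once.\<close>

lemma mix_perspective:
  fixes d :: "('b::real_normed_vector) ^ 'n"
  shows "(\<Sum>i\<in>UNIV. (norm (mix (A t) d $ i))\<^sup>2 / w (Suc t) $ i) \<le> (\<Sum>j\<in>UNIV. (norm (d $ j))\<^sup>2 / w t $ j)"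
proof -
  have "(norm (mix (A t) d $ i))\<^sup>2 / w (Suc t) $ i \<le> (\<Sum>j\<in>UNIV. A t $ i $ j * ((norm (d $ j))\<^sup>2 / w t $ j))" for i
  proof -
    have "norm (mix (A t) d $ i) \<le> (\<Sum>j\<in>UNIV. A t $ i $ j * norm (d $ j))"
      unfolding mix_nth by (rule order.trans[OF norm_sum]) (simp add: A_nonneg)
    \<comment> \<open>The split for Cauchy-Schwarz: the squares of the first factors sum to the new
      weight of \<open>i\<close>, those of the second to the mixed perspectives.\<close>
    also have "\<dots> = (\<Sum>j\<in>UNIV. sqrt (A t $ i $ j * w t $ j) * (sqrt (A t $ i $ j / w t $ j) * norm (d $ j)))"
      using w_pos[of t] A_nonneg
      by (intro sum.cong) (auto simp: real_sqrt_mult[symmetric] mult.assoc[symmetric] less_imp_neq[THEN not_sym])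
    finally have "(norm (mix (A t) d $ i))\<^sup>2 \<le>
        (\<Sum>j\<in>UNIV. sqrt (A t $ i $ j * w t $ j) * (sqrt (A t $ i $ j / w t $ j) * norm (d $ j)))\<^sup>2"
      by (intro power_mono) auto
    also have "\<dots> \<le> (\<Sum>j\<in>UNIV. (sqrt (A t $ i $ j * w t $ j))\<^sup>2) *
        (\<Sum>j\<in>UNIV. (sqrt (A t $ i $ j / w t $ j) * norm (d $ j))\<^sup>2)"
      by (rule Cauchy_Schwarz_ineq_sum)
    also have "\<dots> = w (Suc t) $ i * (\<Sum>j\<in>UNIV. A t $ i $ j * ((norm (d $ j))\<^sup>2 / w t $ j))"
      using w_nonneg A_nonneg by (simp add: w_Suc mix_nth power_mult_distrib)
    finally show ?thesis using w_pos[of "Suc t" i] by (simp add: divide_simps mult.commute)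
  qed
  then have "(\<Sum>i\<in>UNIV. (norm (mix (A t) d $ i))\<^sup>2 / w (Suc t) $ i)
      \<le> (\<Sum>i\<in>UNIV. \<Sum>j\<in>UNIV. A t $ i $ j * ((norm (d $ j))\<^sup>2 / w t $ j))"
    by (rule sum_mono)
  also have "\<dots> = (\<Sum>j\<in>UNIV. \<Sum>i\<in>UNIV. A t $ i $ j * ((norm (d $ j))\<^sup>2 / w t $ j))"
    by (rule sum.swap)
  also have "\<dots> = (\<Sum>j\<in>UNIV. (norm (d $ j))\<^sup>2 / w t $ j)"
    by (simp only: sum_distrib_right[symmetric] column_stochastic) simp
  finally show ?thesis .
qed

end

section \<open>Estimates for convex functions and sums\<close>

text \<open>Convexity on a whole finite-dimensional space gives continuity, hence bounds on balls. A
  subgradient is bounded by testing its inequality one unit away in its own direction, which is why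
  the ball has radius \<open>R + 1\<close>.\<close>

lemma convex_coord_space_bounds:
  fixes X :: "(real ^ 'd::finite) set"
  assumes h: "convex_on (coord_space D) h" and X: "bounded X" "X \<subseteq> coord_space D"
  shows "\<exists>B>0. \<forall>u\<in>X. \<bar>h u\<bar> \<le> B \<and> (\<forall>v\<in>subdiff (coord_space D) h u. norm v \<le> B)"
proof -
  \<comment> \<open>Precomposing with the coordinate projection makes the function convex on the
    full space, an open set, where convexity implies continuity.\<close>
  define p :: "real ^ 'd \<Rightarrow> real ^ 'd" where "p v = (\<chi> k. if k \<in> D then v $ k else 0)" for v
  have p_in: "p v \<in> coord_space D" for v by (auto simp: p_def coord_space_def)
  have p_id: "p v = v" if "v \<in> coord_space D" for v
    using that by (auto simp: p_def coord_space_def vec_eq_iff)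
  have p_lin: "p (c *\<^sub>R u + d *\<^sub>R v) = c *\<^sub>R p u + d *\<^sub>R p v" for c d u v
    by (auto simp: p_def vec_eq_iff)
  have "convex_on UNIV (h \<circ> p)"
    using convex_onD[OF h] p_in by (intro convex_onI) (auto simp: p_lin)
  then have cont: "continuous_on UNIV (h \<circ> p)" by (rule convex_on_continuous[OF open_UNIV])
  obtain R where R: "\<And>u. u \<in> X \<Longrightarrow> norm u \<le> R" using X(1) by (auto simp: bounded_iff)
  have "bounded ((h \<circ> p) ` cball 0 (R + 1))"
    by (intro compact_imp_bounded compact_continuous_image continuous_on_subset[OF cont]) auto
  then obtain M where "\<forall>v\<in>cball 0 (R + 1). \<bar>h (p v)\<bar> \<le> M"
    by (auto simp: bounded_iff)
  then have M: "\<bar>h (p v)\<bar> \<le> M" if "norm v \<le> R + 1" for v using that by auto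
  have "norm v \<le> 2 * M" if u: "u \<in> X" and v: "v \<in> subdiff (coord_space D) h u" for u v
  proof (cases "v = 0")
    case True
    then show ?thesis using M[of u] R[OF u] by simp
  next
    case False
    define z where "z = u + v /\<^sub>R norm v"
    have "z \<in> coord_space D" using subsetD[OF X(2) u] v by (simp add: z_def coord_space_def subdiff_def)
    then have "h z \<ge> h u + v \<bullet> (z - u)" using v by (auto simp: subdiff_def)
    also have "v \<bullet> (z - u) = norm v"
      using False by (simp add: z_def dot_square_norm power2_eq_square)
    finally have "norm v \<le> h z - h u" by simp
    moreover have "norm z \<le> R + 1"
      using R[OF u] False unfolding z_def by (intro norm_triangle_le) simp
    ultimately show ?thesis
      using M[of z] M[of u] R[OF u] p_id[OF \<open>z \<in> _\<close>] p_id[OF subsetD[OF X(2) u]] by simp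
  qed
  moreover have "\<bar>h u\<bar> \<le> M" if "u \<in> X" for u
    using M[of u] R[OF that] p_id[OF subsetD[OF X(2) that]] by simp
  moreover have "2 * \<bar>M\<bar> + 1 > 0" "M \<le> 2 * \<bar>M\<bar> + 1" "2 * M \<le> 2 * \<bar>M\<bar> + 1" by simp_all
  ultimately show ?thesis by (meson order.trans)
qed

text \<open>Later \<open>v\<close> is either the mixed multiplier or a multiple \<open>w p\<close>.
  Both lie in the orthant, so clipping an update only brings it closer to them.\<close>

lemma norm_pos_part_diff_le:
  fixes u v :: "real ^ 'm::finite"
  assumes "\<And>k. 0 \<le> v $ k"
  shows "norm (pos_part u - v) \<le> norm (u - v)"
proof (rule norm_le_componentwise_cart)
  fix k
  show "norm ((pos_part u - v) $ k) \<le> norm ((u - v) $ k)"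
    using assms[of k] by (auto simp: pos_part_def)
qed

text \<open>The convolution obeys \<open>u (Suc t) = \<rho> * u t + \<gamma> t\<close>; summing this
  relation over time produces the factor \<open>1 / (1 - \<rho>)\<close>.\<close>

lemma convolution_sum:
  fixes \<gamma> :: "nat \<Rightarrow> real"
  assumes "\<rho> < 1" "0 \<le> \<rho>" "\<And>s. 0 \<le> \<gamma> s"
  shows "(\<Sum>t=1..T. \<Sum>s<t. \<rho> ^ (t - Suc s) * \<gamma> s) \<le> (\<Sum>s<Suc T. \<gamma> s) / (1 - \<rho>)"
proof -
  define u where "u t = (\<Sum>s<t. \<rho> ^ (t - Suc s) * \<gamma> s)" for t
  have u_Suc: "u (Suc t) = \<rho> * u t + \<gamma> t" for t
  proof -
    have "(\<Sum>s<t. \<rho> ^ (Suc t - Suc s) * \<gamma> s) = (\<Sum>s<t. \<rho> * (\<rho> ^ (t - Suc s) * \<gamma> s))"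
    proof (rule sum.cong)
      fix s assume "s \<in> {..<t}"
      then have "Suc t - Suc s = Suc (t - Suc s)" by auto
      then show "\<rho> ^ (Suc t - Suc s) * \<gamma> s = \<rho> * (\<rho> ^ (t - Suc s) * \<gamma> s)" by simp
    qed simp
    then show ?thesis by (simp add: u_def sum_distrib_left)
  qed
  have "(1 - \<rho>) * (\<Sum>t<T. u t) + u T = (\<Sum>s<T. \<gamma> s)" for T
    proof (induction T)
    case (Suc T)
    have "(1 - \<rho>) * (\<Sum>t<Suc T. u t) + u (Suc T) = ((1 - \<rho>) * (\<Sum>t<T. u t) + u T) + \<gamma> T"
      by (simp add: u_Suc algebra_simps)
    then show ?case using Suc by simp
  qed (simp add: u_def)
  from this[of "Suc T"] have "(1 - \<rho>) * (\<Sum>t<Suc T. u t) \<le> (\<Sum>s<Suc T. \<gamma> s)"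
    using sum_nonneg[of "{..<Suc T}" "\<lambda>s. \<rho> ^ (Suc T - Suc s) * \<gamma> s"] assms by (auto simp: u_def)
  moreover have "(\<Sum>t=1..T. u t) \<le> (\<Sum>t<Suc T. u t)"
    by (rule sum_mono2) (auto simp: u_def assms intro!: sum_nonneg)
  ultimately have "(1 - \<rho>) * (\<Sum>t=1..T. u t) \<le> (\<Sum>s<Suc T. \<gamma> s)"
    using assms by (smt (verit) mult_left_mono)
  then show ?thesis using assms by (simp add: u_def pos_le_divide_eq mult.commute)
qed

lemma geometric_convolution_le:
  fixes \<rho> :: real
  assumes "0 \<le> \<rho>" "\<rho> < 1"
  shows "(\<Sum>s<t. \<rho> ^ (t - Suc s)) \<le> 1 / (1 - \<rho>)"
proof -
  have "(\<Sum>s<t. \<rho> ^ (t - Suc s)) = (\<Sum>s<t. \<rho> ^ s)" by (rule sum.nat_diff_reindex)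
  also have "\<dots> = (1 - \<rho> ^ t) / (1 - \<rho>)" using assms by (simp add: sum_gp_strict)
  also have "\<dots> \<le> 1 / (1 - \<rho>)" using assms by (intro divide_right_mono) auto
  finally show ?thesis .
qed

lemma sum_powr_le:
  assumes "0 \<le> p" "p < (1::real)"
  shows "(\<Sum>t=1..T. 1 / real t powr p) \<le> real T powr (1 - p) / (1 - p)"
proof (induction T)
  case (Suc T)
  have step: "real T powr (1 - p) + (1 - p) / real (Suc T) powr p \<le> real (Suc T) powr (1 - p)"
  proof (cases "T = 0")
    case True
    then show ?thesis using assms by simp
  next
    case False
    \<comment> \<open>Weighted arithmetic-geometric mean inequality, in place of a comparison with
      an integral.\<close>
    have "real T powr (1 - p) * real (Suc T) powr p \<le> (1 - p) * real T + p * real (Suc T)"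
      using assms False by (intro Youngs_inequality_0) auto
    then have "real T powr (1 - p) * real (Suc T) powr p + (1 - p) \<le> real (Suc T)"
      by (simp add: algebra_simps)
    also have "\<dots> = real (Suc T) powr (1 - p) * real (Suc T) powr p"
      by (simp flip: powr_add)
    finally show ?thesis by (simp add: field_simps)
  qed
  have "(\<Sum>t=1..Suc T. 1 / real t powr p) \<le> real T powr (1 - p) / (1 - p) + 1 / real (Suc T) powr p"
    using Suc by simp
  also have "\<dots> = (real T powr (1 - p) + (1 - p) / real (Suc T) powr p) / (1 - p)"
    using assms by (simp add: field_simps)
  also have "\<dots> \<le> real (Suc T) powr (1 - p) / (1 - p)"
    using step assms by (intro divide_right_mono) auto
  finally show ?case .
qed simp

text \<open>Summation by parts with nondecreasing weights. The bound \<open>M\<close> is asked only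
  up to time \<open>T\<close> because the one for \<open>drift\<close> grows with
  \<open>T\<close>.\<close>

lemma abel_sum_le:
  fixes c W :: "nat \<Rightarrow> real"
  assumes "0 \<le> c 1" "\<And>t. 1 \<le> t \<Longrightarrow> c t \<le> c (Suc t)" "\<And>t. 0 \<le> W t"
    and "1 \<le> T" "\<And>t. 1 \<le> t \<Longrightarrow> t \<le> T \<Longrightarrow> W t \<le> M"
  shows "(\<Sum>t=1..T. c t * (W t - W (Suc t))) \<le> c T * M"
proof -
  have c: "0 \<le> c t" if "1 \<le> t" for t using that
    by (induction t rule: dec_induct) (use assms(1,2) in \<open>auto intro: order.trans\<close>)
  \<comment> \<open>The extra term \<open>c T * W (Suc T)\<close>, dropped afterwards, is what makes
    the induction close.\<close>
  have "(\<Sum>t=1..T. c t * (W t - W (Suc t))) \<le> c T * M - c T * W (Suc T)"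
    using assms(4,5)
  proof (induction T rule: dec_induct)
    case base
    then show ?case using mult_left_mono[OF base(1)[of 1] assms(1)] by (simp add: algebra_simps)
  next
    case (step T)
    have "(c (Suc T) - c T) * W (Suc T) \<le> (c (Suc T) - c T) * M"
      using step assms(2)[of T] by (intro mult_left_mono) auto
    then show ?case using step by (simp add: algebra_simps)
  qed
  also have "\<dots> \<le> c T * M" using c[OF assms(4)] assms(3) by simp
  finally show ?thesis .
qed

section \<open>Slater points and the cost of infeasibility\<close>

lemma convex_stack_set:
  fixes X :: "'n::finite \<Rightarrow> ('a::real_vector) set"
  assumes "\<And>i. convex (X i)"
  shows "convex (stack_set X)"
  unfolding convex_def stack_set_def
  using assms by (auto simp: convex_def)

lemma total_g_convex:
  assumes "\<And>i k. convex_on (coord_space (D i)) (\<lambda>z. g i z $ k)" "\<And>i. X i \<subseteq> coord_space (D i)"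
    and "u \<in> stack_set X" "v \<in> stack_set X" "0 \<le> \<theta>" "\<theta> \<le> 1"
  shows "total_g g ((1 - \<theta>) *\<^sub>R u + \<theta> *\<^sub>R v) $ k \<le> (1 - \<theta>) * total_g g u $ k + \<theta> * total_g g v $ k"
proof -
  have "g i ((1 - \<theta>) *\<^sub>R u $ i + \<theta> *\<^sub>R v $ i) $ k \<le> (1 - \<theta>) * g i (u $ i) $ k + \<theta> * g i (v $ i) $ k" for i
    using assms by (intro convex_onD[OF assms(1)]) (auto simp: stack_set_def subset_iff)
  then have "(\<Sum>i\<in>UNIV. g i ((1 - \<theta>) *\<^sub>R u $ i + \<theta> *\<^sub>R v $ i) $ k)
      \<le> (\<Sum>i\<in>UNIV. (1 - \<theta>) * g i (u $ i) $ k + \<theta> * g i (v $ i) $ k)" by (rule sum_mono)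
  then show ?thesis by (simp add: total_g_def sum.distrib sum_distrib_left)
qed

text \<open>Moving from the Slater point away from an infeasible point makes the linear constraints
  strict as well. This is why uniform bounds on Lagrange multipliers are not needed.\<close>

lemma strict_slater:
  fixes X :: "'n::finite \<Rightarrow> (real ^ 'd::finite) set"
  assumes convex_g: "\<And>i k. convex_on (coord_space (D i)) (\<lambda>z. g i z $ k)"
    and X: "\<And>i. X i \<subseteq> coord_space (D i)" "\<And>i. convex (X i)"
    and slater: "slater D X g"
    and v: "v \<in> stack_set X" "\<And>k. total_g g v $ k > 0"
  obtains z where "z \<in> stack_set X" "\<And>k. total_g g z $ k < 0"
proof -
  have conv: "convex (stack_set X)" by (rule convex_stack_set[OF X(2)])
  obtain u where u: "u \<in> rel_interior (stack_set X)"
    "\<And>k. if linear_component D g k then total_g g u $ k \<le> 0 else total_g g u $ k < 0"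
    using slater unfolding slater_def by blast
  have uX: "u \<in> stack_set X" using u(1) rel_interior_subset by blast
  \<comment> \<open>The segment from \<open>v\<close> to a relative interior point can be prolonged
    beyond that point within the set.\<close>
  obtain e where e: "e > 1" "(1 - e) *\<^sub>R v + e *\<^sub>R u \<in> stack_set X"
    using convex_rel_interior_if[OF conv u(1)] v(1) hull_subset[of "stack_set X" affine] by blast
  define p where "p = (1 - e) *\<^sub>R v + e *\<^sub>R u"
  \<comment> \<open>A linear component is nonpositive at \<open>u\<close> and positive at
    \<open>v\<close>, hence negative at \<open>p\<close>, and any step towards \<open>p\<close>
    makes it strict. The other components are negative at \<open>u\<close> and remain so for small
    steps.\<close>
  have "\<forall>\<^sub>F \<theta> in at_right 0. (1 - \<theta>) * total_g g u $ k + \<theta> * total_g g p $ k < 0" for k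
  proof (cases "linear_component D g k")
    case True
    then obtain c b where cb: "\<And>x. x \<in> stack_set (\<lambda>i. coord_space (D i)) \<Longrightarrow> total_g g x $ k = c \<bullet> x + b"
      unfolding linear_component_def by blast
    have sub: "stack_set X \<subseteq> stack_set (\<lambda>i. coord_space (D i))" using X(1) by (auto simp: stack_set_def)
    have "total_g g p $ k = (1 - e) * total_g g v $ k + e * total_g g u $ k"
      using cb[of p] cb[of u] cb[of v] e(2) uX v(1) sub
      by (auto simp: p_def inner_add_right algebra_simps subset_iff)
    moreover have "(1 - e) * total_g g v $ k < 0" using e v(2)[of k] by (simp add: mult_neg_pos)
    moreover have "e * total_g g u $ k \<le> 0" "total_g g u $ k \<le> 0"
      using u(2)[of k] True e by (auto simp: mult_nonneg_nonpos)
    ultimately have neg: "total_g g p $ k < 0" "total_g g u $ k \<le> 0" by auto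
    have "\<forall>\<^sub>F \<theta> in at_right 0. \<theta> \<in> {0<..<1::real}" by (rule eventually_at_right_real) simp
    then show ?thesis
    proof eventually_elim
      case (elim \<theta>)
      then have "(1 - \<theta>) * total_g g u $ k \<le> 0" "\<theta> * total_g g p $ k < 0"
        using neg by (auto simp: mult_nonneg_nonpos mult_pos_neg)
      then show ?case by linarith
    qed
  next
    case False
    have "((\<lambda>\<theta>. (1 - \<theta>) * total_g g u $ k + \<theta> * total_g g p $ k) \<longlongrightarrow>
        (1 - 0) * total_g g u $ k + 0 * total_g g p $ k) (at_right 0)"
      by (intro tendsto_intros)
    then show ?thesis using u(2)[of k] False by (intro order_tendstoD(2)) auto
  qed
  then have "\<forall>\<^sub>F \<theta> in at_right 0. \<forall>k. (1 - \<theta>) * total_g g u $ k + \<theta> * total_g g p $ k < 0"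
    by (rule eventually_all_finite)
  moreover have "\<forall>\<^sub>F \<theta> in at_right 0. \<theta> \<in> {0<..<1::real}" by (rule eventually_at_right_real) simp
  ultimately have "\<forall>\<^sub>F \<theta> in at_right 0. \<theta> \<in> {0<..<1::real} \<and>
      (\<forall>k. (1 - \<theta>) * total_g g u $ k + \<theta> * total_g g p $ k < 0)" by eventually_elim simp
  then obtain \<theta> :: real where \<theta>: "0 < \<theta>" "\<theta> < 1"
    "\<And>k. (1 - \<theta>) * total_g g u $ k + \<theta> * total_g g p $ k < 0"
    using eventually_happens'[of "at_right (0::real)"] by (auto simp: trivial_limit_at_right_real)
  have pX: "p \<in> stack_set X" using e by (simp add: p_def)
  have "(1 - \<theta>) *\<^sub>R u + \<theta> *\<^sub>R p \<in> stack_set X"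
    using conv uX pX \<theta> by (intro convexD) auto
  moreover have "total_g g ((1 - \<theta>) *\<^sub>R u + \<theta> *\<^sub>R p) $ k < 0" for k
    using total_g_convex[OF convex_g X(1) uX pX less_imp_le[OF \<theta>(1)] less_imp_le[OF \<theta>(2)], of k] \<theta>(3)[of k]
    by linarith
  ultimately show thesis using that by blast
qed

text \<open>Moving from \<open>u\<close> towards the strictly feasible \<open>z\<close> restores
  feasibility after a fraction of the way proportional to the violation, and convexity charges only
  that fraction of the range of the cost.\<close>

lemma infeasible_cost_gap:
  fixes X :: "'n::finite \<Rightarrow> (real ^ 'd::finite) set"
  assumes convex_g: "\<And>i k. convex_on (coord_space (D i)) (\<lambda>z. g i z $ k)"
    and convex_f: "\<And>i. convex_on (coord_space (D i)) (f i t)"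
    and X: "\<And>i. X i \<subseteq> coord_space (D i)" "\<And>i. convex (X i)"
    and f_bounded: "\<And>i u. u \<in> X i \<Longrightarrow> \<bar>f i t u\<bar> \<le> B"
    and z: "z \<in> stack_set X" "\<And>k. total_g g z $ k \<le> - \<delta>" "\<delta> > 0"
    and u: "u \<in> stack_set X" "\<And>k. total_g g u $ k \<ge> 0"
    and opt: "\<And>v. v \<in> feasible_set X g \<Longrightarrow> total_f f t xs \<le> total_f f t v"
  shows "total_f f t u \<ge> total_f f t xs - 2 * real CARD('n) * B / \<delta> * (\<Sum>k\<in>UNIV. total_g g u $ k)"
proof -
  define r where "r = (\<Sum>k\<in>UNIV. total_g g u $ k)"
  have r: "r \<ge> 0" "total_g g u $ k \<le> r" for k
    unfolding r_def using u(2) by (auto intro!: sum_nonneg member_le_sum)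
  \<comment> \<open>Chosen so that \<open>(1 - \<theta>) * r = \<theta> * \<delta>\<close>: the
    slack at \<open>z\<close> exactly offsets the violation. The bound
    \<open>\<theta> \<le> r / \<delta>\<close> makes the price linear.\<close>
  define \<theta> where "\<theta> = r / (r + \<delta>)"
  have \<theta>: "0 \<le> \<theta>" "\<theta> \<le> 1" "\<theta> \<le> r / \<delta>" "(1 - \<theta>) * r = \<theta> * \<delta>"
    using r z(3) by (auto simp: \<theta>_def field_simps intro!: divide_left_mono)
  define v where "v = (1 - \<theta>) *\<^sub>R u + \<theta> *\<^sub>R z"
  have fin: "\<bar>total_f f t q\<bar> \<le> real CARD('n) * B" if "q \<in> stack_set X" for q
  proof -
    have "\<bar>total_f f t q\<bar> \<le> (\<Sum>i\<in>(UNIV::'n set). B)"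
      unfolding total_f_def using that
      by (intro order.trans[OF sum_abs] sum_mono f_bounded) (auto simp: stack_set_def)
    then show ?thesis by simp
  qed
  have "v \<in> stack_set X" unfolding v_def
    using convex_stack_set[OF X(2)] u z \<theta> by (intro convexD) auto
  moreover have "total_g g v $ k \<le> 0" for k
  proof -
    have "total_g g v $ k \<le> (1 - \<theta>) * total_g g u $ k + \<theta> * total_g g z $ k"
      unfolding v_def using convex_g X(1) u(1) z(1) \<theta>(1,2) by (rule total_g_convex)
    also have "\<dots> \<le> (1 - \<theta>) * r + \<theta> * (- \<delta>)"
      using \<theta> r z(2) by (intro add_mono mult_left_mono) auto
    finally show ?thesis using \<theta>(4) by simp
  qed
  ultimately have "total_f f t xs \<le> total_f f t v" by (intro opt) (simp add: feasible_set_def)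
  also have "\<dots> \<le> (1 - \<theta>) * total_f f t u + \<theta> * total_f f t z"
  proof -
    have "f i t ((1 - \<theta>) *\<^sub>R u $ i + \<theta> *\<^sub>R z $ i) \<le> (1 - \<theta>) * f i t (u $ i) + \<theta> * f i t (z $ i)" for i
      using \<theta> X(1) u(1) z(1) by (intro convex_onD[OF convex_f]) (auto simp: stack_set_def)
    then have "(\<Sum>i\<in>UNIV. f i t ((1 - \<theta>) *\<^sub>R u $ i + \<theta> *\<^sub>R z $ i))
        \<le> (\<Sum>i\<in>UNIV. (1 - \<theta>) * f i t (u $ i) + \<theta> * f i t (z $ i))" by (rule sum_mono)
    then show ?thesis by (simp add: total_f_def v_def sum.distrib sum_distrib_left)
  qed
  also have "\<dots> = total_f f t u + \<theta> * (total_f f t z - total_f f t u)" by (simp add: algebra_simps)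
  also have "\<dots> \<le> total_f f t u + r / \<delta> * (2 * (real CARD('n) * B))"
  proof -
    have "\<theta> * (total_f f t z - total_f f t u) \<le> \<theta> * (2 * (real CARD('n) * B))"
      using fin[OF u(1)] fin[OF z(1)] \<theta>(1) by (intro mult_left_mono) auto
    also have "\<dots> \<le> r / \<delta> * (2 * (real CARD('n) * B))"
      using fin[OF u(1)] \<theta>(3) by (intro mult_right_mono) auto
    finally show ?thesis by simp
  qed
  finally show ?thesis by (simp add: r_def algebra_simps)
qed

section \<open>Boundedness and consensus of the iterates\<close>

locale dopp = push_sum A E a Q w n_agents period \<eta>
  for A :: "nat \<Rightarrow> real ^ 'n::finite ^ 'n" and E a Q w n_agents period \<eta> +
  fixes D :: "'n \<Rightarrow> 'd::finite set"
    and X :: "'n \<Rightarrow> (real ^ 'd) set"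
    and f :: "'n \<Rightarrow> nat \<Rightarrow> real ^ 'd \<Rightarrow> real"
    and g :: "'n \<Rightarrow> real ^ 'd \<Rightarrow> real ^ 'm::finite"
    and B_f C_f \<kappa> :: real
    and \<alpha> \<beta> :: "nat \<Rightarrow> real"
    and x s :: "nat \<Rightarrow> real ^ 'd ^ 'n"
    and \<mu> y :: "nat \<Rightarrow> real ^ 'm ^ 'n"
  assumes X_sub: "\<And>i. X i \<subseteq> coord_space (D i)"
    and convex_f: "\<And>i t. convex_on (coord_space (D i)) (f i t)"
    and convex_g: "\<And>i k. convex_on (coord_space (D i)) (\<lambda>z. g i z $ k)"
    and convex_X: "\<And>i. convex (X i)" and compact_X: "\<And>i. compact (X i)"
    and B_f_pos: "B_f > 0" and C_f_pos: "C_f > 0"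
    and f_bounded: "\<And>t i u. u \<in> X i \<Longrightarrow> \<bar>f i t u\<bar> \<le> B_f"
    and f_subgradient: "\<And>t i u v. u \<in> X i \<Longrightarrow> v \<in> subdiff (coord_space (D i)) (f i t) u \<Longrightarrow> norm v \<le> C_f"
    and kappa: "0 < \<kappa>" "\<kappa> < 1 / 4"
    and alpha: "\<alpha> 0 = 1" "\<And>t. t \<ge> 1 \<Longrightarrow> \<alpha> t = 1 / sqrt (real t)"
    and beta: "\<beta> 0 = 1" "\<And>t. t \<ge> 1 \<Longrightarrow> \<beta> t = 1 / real t powr \<kappa>"
    and run: "dopp_run A D X f g \<alpha> \<beta> x w \<mu> y s"
begin

text \<open>\<open>\<nu>\<close> and \<open>Y\<close> are the push-sum estimates that agent
  \<open>i\<close> has of \<open>\<mu>_mean t\<close> and of \<open>G t /\<^sub>R n_agents\<close>.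
  The weight of time \<open>Suc t\<close> is the one that underwent the same mixing.\<close>

definition "\<nu> t i = mix (A t) (\<mu> t) $ i /\<^sub>R w (Suc t) $ i"
definition "Y t i = mix (A t) (y t) $ i /\<^sub>R w (Suc t) $ i"
definition "G t = total_g g (x t)"
definition "\<mu>_mean t = (\<Sum>i\<in>UNIV. \<mu> t $ i) /\<^sub>R n_agents"

lemma run_init: "x 0 $ i \<in> X i" "\<mu> 0 $ i = 0" "y 0 $ i = g i (x 0 $ i)"
  using run by (auto simp: dopp_run_def)

lemma run_step:
  "\<exists>u \<in> subdiff (coord_space (D i)) (f i t) (x t $ i).
     \<exists>H \<in> subdiff_mat (coord_space (D i)) (g i) (x t $ i). s (Suc t) $ i = u + H *v \<nu> t i"
  "x (Suc t) $ i = closest_point (X i) (x t $ i - \<alpha> t *\<^sub>R s (Suc t) $ i)"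
  "\<mu> (Suc t) $ i = pos_part (mix (A t) (\<mu> t) $ i + \<alpha> t *\<^sub>R (Y t i - \<beta> t *\<^sub>R mix (A t) (\<mu> t) $ i))"
  "y (Suc t) $ i = mix (A t) (y t) $ i + g i (x (Suc t) $ i) - g i (x t $ i)"
  using run unfolding dopp_run_def Let_def \<nu>_def Y_def by blast+

lemma mix_mu: "mix (A t) (\<mu> t) $ i = w (Suc t) $ i *\<^sub>R \<nu> t i"
  using w_pos[of "Suc t" i] by (simp add: \<nu>_def)

section \<open>Step sizes and regularization weights\<close>

lemma alpha_pos: "\<alpha> t > 0" and alpha_le_1: "\<alpha> t \<le> 1"
proof -
  have "\<alpha> t > 0 \<and> \<alpha> t \<le> 1" using alpha(1) alpha(2)[of t] by (cases "t = 0") auto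
  then show "\<alpha> t > 0" "\<alpha> t \<le> 1" by auto
qed

lemma beta_pos: "\<beta> t > 0" and beta_le_1: "\<beta> t \<le> 1"
proof -
  have "1 \<le> real t powr \<kappa>" if "t \<ge> 1" using that kappa by (intro ge_one_powr_ge_zero) auto
  then have "\<beta> t > 0 \<and> \<beta> t \<le> 1" using beta(1) beta(2)[of t] by (cases "t = 0") auto
  then show "\<beta> t > 0" "\<beta> t \<le> 1" by auto
qed

lemma beta_antimono: "t \<le> T \<Longrightarrow> \<beta> T \<le> \<beta> t"
proof (cases "t = 0")
  case True
  then show ?thesis using beta beta_le_1 by simp
next
  case False
  assume "t \<le> T"
  then have "real t powr \<kappa> \<le> real T powr \<kappa>" using kappa by (intro powr_mono2) auto
  then show ?thesis using False \<open>t \<le> T\<close> beta(2)[of t] beta(2)[of T]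
    by (simp add: divide_left_mono)
qed

lemma inverse_beta_mono: "t \<le> T \<Longrightarrow> 1 / \<beta> t \<le> 1 / \<beta> T"
  using beta_antimono[of t T] beta_pos by (simp add: divide_left_mono)

lemma sum_alpha: "1 \<le> T \<Longrightarrow> (\<Sum>t=1..T. \<alpha> t) \<le> 2 * sqrt (real T)"
  using sum_powr_le[of "1/2" T] alpha by (simp add: powr_half_sqrt)

text \<open>Time 0 is included because the convolutions contain the perturbation made then.\<close>

lemma sum_alpha_0: "1 \<le> T \<Longrightarrow> (\<Sum>t<Suc T. \<alpha> t) \<le> 3 * sqrt (real T)"
proof -
  assume T: "1 \<le> T"
  have "{..<Suc T} = insert 0 {1..T}" by auto
  then have "(\<Sum>t<Suc T. \<alpha> t) = 1 + (\<Sum>t=1..T. \<alpha> t)" using alpha by simp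
  moreover have "1 \<le> sqrt (real T)" using T by simp
  ultimately show ?thesis using sum_alpha[OF T] by linarith
qed

section \<open>Constraint values and their tracked averages\<close>

lemma x_in: "x t $ i \<in> X i"
proof (cases t)
  case (Suc t')
  then show ?thesis unfolding Suc run_step(2) using run_init(1) compact_X
    by (intro closest_point_in_set) (auto simp: compact_imp_closed)
qed (simp add: run_init)

text \<open>The bounds come from convexity on the whole coordinate space and compactness of
  \<open>X i\<close>; summing over agents and components gives a single constant.\<close>

lemma g_bounds:
  obtains B where "B > 0" "\<And>i u. u \<in> X i \<Longrightarrow> norm (g i u) \<le> B"
    "\<And>i u H k. u \<in> X i \<Longrightarrow> H \<in> subdiff_mat (coord_space (D i)) (g i) u \<Longrightarrow> norm (column k H) \<le> B"
proof -
  have "\<exists>B>0. \<forall>u\<in>X i. \<bar>g i u $ k\<bar> \<le> B \<and>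
      (\<forall>v\<in>subdiff (coord_space (D i)) (\<lambda>z. g i z $ k) u. norm v \<le> B)" for i k
    by (rule convex_coord_space_bounds[OF convex_g compact_imp_bounded[OF compact_X] X_sub])
  then obtain B where B: "\<And>i k. B i k > 0" "\<And>i k u. u \<in> X i \<Longrightarrow> \<bar>g i u $ k\<bar> \<le> B i k"
     "\<And>i k u v. u \<in> X i \<Longrightarrow> v\<in>subdiff (coord_space (D i)) (\<lambda>z. g i z $ k) u \<Longrightarrow> norm v \<le> B i k"
    by metis
  define C where "C = (\<Sum>i\<in>UNIV. \<Sum>k\<in>UNIV. B i k)"
  have inner: "(\<Sum>k\<in>UNIV. B i k) \<le> C" for i
    unfolding C_def by (rule member_le_sum) (auto intro!: sum_nonneg B(1)[THEN less_imp_le])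
  have elem: "B i k \<le> C" for i k
    using inner[of i] member_le_sum[of k UNIV "B i"] B(1) by (force simp: less_imp_le)
  have "norm (g i u) \<le> C" if "u \<in> X i" for i u
  proof -
    have "norm (g i u) \<le> (\<Sum>k\<in>UNIV. \<bar>g i u $ k\<bar>)" by (rule norm_le_l1_cart)
    also have "\<dots> \<le> (\<Sum>k\<in>UNIV. B i k)" by (intro sum_mono B that)
    finally show ?thesis using inner[of i] by simp
  qed
  moreover have "norm (column k H) \<le> C"
    if "u \<in> X i" "H \<in> subdiff_mat (coord_space (D i)) (g i) u" for i u H k
    using B(3)[of u i "column k H" k] that elem[of i k] by (auto simp: subdiff_mat_def)
  moreover have "C > 0" using elem B(1) by (meson less_le_trans)
  ultimately show thesis using that by blast
qed

lemma y_perturbed: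
  "y (Suc t) = mix (A t) (y t) + (\<chi> i. g i (x (Suc t) $ i) - g i (x t $ i))"
  by (simp add: vec_eq_iff run_step(4))

text \<open>The tracking invariant: mixing conserves the total of \<open>y\<close>, and the added
  increments telescope from the initial values of \<open>g\<close>.\<close>

lemma sum_y: "(\<Sum>i\<in>UNIV. y t $ i) = G t"
proof (induction t)
  case 0
  show ?case by (simp add: run_init G_def total_g_def)
next
  case (Suc t)
  have "(\<Sum>i\<in>UNIV. y (Suc t) $ i) = G t + (G (Suc t) - G t)"
    unfolding y_perturbed using Suc
    by (simp add: sum.distrib sum_mix G_def total_g_def sum_subtractf)
  then show ?case by simp
qed

lemma G_bounded: obtains B where "B > 0" "\<And>t. norm (G t) \<le> B"
proof -
  obtain Bg where Bg: "Bg > 0" "\<And>i u. u \<in> X i \<Longrightarrow> norm (g i u) \<le> Bg"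
    by (rule g_bounds) blast
  have "norm (G t) \<le> n_agents * Bg" for t
  proof -
    have "norm (G t) \<le> (\<Sum>i\<in>(UNIV::'n set). Bg)"
      unfolding G_def total_g_def by (rule order.trans[OF norm_sum]) (intro sum_mono Bg x_in)
    then show ?thesis by (simp add: n_agents_def)
  qed
  moreover have "n_agents * Bg > 0" using Bg n_agents_ge_1 by simp
  ultimately show thesis using that by blast
qed

text \<open>Only the crude increment bound \<open>2 * Bg\<close> enters: the sharper one in
  \<open>g_move_le\<close> rests on the multiplier bound, which in turn rests on this lemma.\<close>

lemma Y_bounded: obtains B where "B > 0" "\<And>t i. norm (Y t i) \<le> B"
proof -
  obtain Bg where Bg: "Bg > 0" "\<And>i u. u \<in> X i \<Longrightarrow> norm (g i u) \<le> Bg"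
    by (rule g_bounds) blast
  obtain BG where BG: "BG > 0" "\<And>t. norm (G t) \<le> BG" by (rule G_bounded) blast
  obtain C \<rho> where C: "C > 0" "0 < \<rho>" "\<rho> < 1"
    "\<And>(h :: nat \<Rightarrow> (real^'m) ^ 'n) e t i.
       (\<And>t. h (Suc t) = mix (A t) (h t) + e t) \<Longrightarrow>
       norm (mix (A t) (h t) $ i /\<^sub>R w (Suc t) $ i - (\<Sum>j\<in>UNIV. h t $ j) /\<^sub>R n_agents)
         \<le> C * (\<rho> ^ t * (\<Sum>j\<in>UNIV. norm (h 0 $ j)) + (\<Sum>s<t. \<rho> ^ (t - Suc s) * (\<Sum>j\<in>UNIV. norm (e s $ j))))"
    by (rule perturbed_consensus) blast
  define S where "S = (\<Sum>j\<in>UNIV. norm (y 0 $ j))"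
  have S: "S \<ge> 0" by (simp add: S_def sum_nonneg)
  have "norm (Y t i) \<le> C * (S + n_agents * (2 * Bg) / (1 - \<rho>)) + BG" for t i
  proof -
    have incr: "(\<Sum>j\<in>UNIV. norm (g j (x (Suc s) $ j) - g j (x s $ j))) \<le> n_agents * (2 * Bg)" for s
    proof -
      have "(\<Sum>j\<in>UNIV. norm (g j (x (Suc s) $ j) - g j (x s $ j))) \<le> (\<Sum>j\<in>(UNIV::'n set). Bg + Bg)"
        by (intro sum_mono norm_triangle_le_diff add_mono Bg x_in)
      then show ?thesis by (simp add: n_agents_def)
    qed
    have "norm (Y t i - G t /\<^sub>R n_agents) \<le> C * (\<rho> ^ t * S +
       (\<Sum>s<t. \<rho> ^ (t - Suc s) * (\<Sum>j\<in>UNIV. norm (g j (x (Suc s) $ j) - g j (x s $ j)))))"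
      using C(4)[OF y_perturbed, of t i] unfolding sum_y Y_def S_def by simp
    also have "\<dots> \<le> C * (1 * S + (\<Sum>s<t. \<rho> ^ (t - Suc s) * (n_agents * (2 * Bg))))"
      using C S by (intro mult_left_mono add_mono sum_mono mult_right_mono incr) (auto simp: power_le_one)
    also have "\<dots> = C * (S + n_agents * (2 * Bg) * (\<Sum>s<t. \<rho> ^ (t - Suc s)))"
      by (simp add: sum_distrib_left mult.commute)
    also have "\<dots> \<le> C * (S + n_agents * (2 * Bg) * (1 / (1 - \<rho>)))"
      using C Bg n_agents_ge_1 by (intro mult_left_mono add_left_mono geometric_convolution_le) auto
    finally have "norm (Y t i - G t /\<^sub>R n_agents) \<le> C * (S + n_agents * (2 * Bg) / (1 - \<rho>))" by simp
    moreover have "norm (G t /\<^sub>R n_agents) \<le> BG"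
    proof -
      have "norm (G t /\<^sub>R n_agents) = norm (G t) / n_agents"
        using n_agents_ge_1 by (simp add: divide_inverse mult.commute)
      also have "\<dots> \<le> norm (G t)" using n_agents_ge_1 mult_left_mono[of 1 n_agents "norm (G t)"]
        by (simp add: divide_le_eq)
      finally show ?thesis using BG(2)[of t] by simp
    qed
    ultimately show ?thesis using norm_triangle_sub[of "Y t i" "G t /\<^sub>R n_agents"] by simp
  qed
  moreover have "C * (S + n_agents * (2 * Bg) / (1 - \<rho>)) + BG > 0"
    using C S Bg BG n_agents_ge_1 by (intro add_nonneg_pos mult_nonneg_nonneg add_nonneg_nonneg) auto
  ultimately show thesis using that by blast
qed

section \<open>Bounds on multipliers, subgradients and increments\<close>

lemma mu_nonneg: "\<mu> t $ i $ k \<ge> 0"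
  by (cases t) (auto simp: run_init run_step(3) pos_part_def)

lemma mix_mu_nonneg: "mix (A t) (\<mu> t) $ i $ k \<ge> 0"
  by (auto simp: mix_nth intro!: sum_nonneg mult_nonneg_nonneg A_nonneg mu_nonneg)

lemma nu_nonneg: "\<nu> t i $ k \<ge> 0"
  using w_pos[of "Suc t" i] by (simp add: \<nu>_def mix_mu_nonneg)

text \<open>At the level \<open>(B / \<beta>) w\<close> the regularization pulls down by
  \<open>B w\<close>, and \<open>B = By / a ^ period\<close> makes this at least what
  \<open>Y\<close> can push up, so the region below the level is invariant. Measuring in units of
  \<open>w\<close> makes the level compatible with mixing, and since \<open>\<beta>\<close> is
  nonincreasing the level never falls below its earlier multiple of \<open>w\<close>.\<close>

lemma mu_componentwise_bounded:
  obtains B where "B > 0" "\<And>t i k. \<mu> t $ i $ k \<le> B / \<beta> t * w t $ i"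
    "\<And>t i k. mix (A t) (\<mu> t) $ i $ k \<le> B / \<beta> t * w (Suc t) $ i"
proof -
  obtain By where By: "By > 0" "\<And>t i. norm (Y t i) \<le> By" by (rule Y_bounded) blast
  define B where "B = By / a ^ period"
  have B: "B > 0" using By a_pos by (simp add: B_def)
  have mix_bound: "mix (A t) (\<mu> t) $ i $ k \<le> B / \<beta> t * w (Suc t) $ i"
    if "\<And>j. \<mu> t $ j $ k \<le> B / \<beta> t * w t $ j" for t i k
  proof -
    have "mix (A t) (\<mu> t) $ i $ k = mix (A t) (\<chi> j. \<mu> t $ j $ k) $ i"
      by (simp add: mix_nth)
    also have "\<dots> \<le> mix (A t) ((B / \<beta> t) *\<^sub>R w t) $ i"
      by (rule mix_mono) (use that in simp)
    finally show ?thesis by (simp add: mix_scaleR w_Suc)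
  qed
  have bound: "\<forall>i k. \<mu> t $ i $ k \<le> B / \<beta> t * w t $ i" for t
  proof (induction t)
    case 0
    show ?case using B beta_pos[of 0] w_nonneg by (simp add: run_init)
  next
    case (Suc t)
    show ?case
    proof (intro allI)
      fix i k
      define m where "m = mix (A t) (\<mu> t) $ i $ k"
      define W where "W = w (Suc t) $ i"
      have W: "W > 0" "a ^ period \<le> W" using w_pos w_ge by (auto simp: W_def)
      have m: "m \<le> B / \<beta> t * W" unfolding m_def W_def using Suc by (intro mix_bound) auto
      \<comment> \<open>The coefficient of \<open>m\<close> in the update is thus nonnegative, so
        the bound on \<open>m\<close> may be inserted.\<close>
      have "\<alpha> t * \<beta> t \<le> 1" using mult_mono[of "\<alpha> t" 1 "\<beta> t" 1] alpha_le_1 beta_le_1 alpha_pos[of t] beta_pos[of t] by simp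
      then have "(1 - \<alpha> t * \<beta> t) * m \<le> (1 - \<alpha> t * \<beta> t) * (B / \<beta> t * W)"
        by (intro mult_left_mono m) auto
      moreover have "\<alpha> t * Y t i $ k \<le> \<alpha> t * (B * W)"
      proof (intro mult_left_mono)
        have "Y t i $ k \<le> By" using component_le_norm_cart[of "Y t i" k] By(2)[of t i] by simp
        also have "By = B * a ^ period" using a_pos by (simp add: B_def)
        also have "\<dots> \<le> B * W" using B W by simp
        finally show "Y t i $ k \<le> B * W" .
      qed (use alpha_pos[of t] in simp)
      ultimately have "m + \<alpha> t * (Y t i $ k - \<beta> t * m)
          \<le> (1 - \<alpha> t * \<beta> t) * (B / \<beta> t * W) + \<alpha> t * (B * W)"
        by (simp add: algebra_simps)
      also have "\<dots> = B / \<beta> t * W" using beta_pos[of t] by (simp add: field_simps)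
      finally have "\<mu> (Suc t) $ i $ k \<le> B / \<beta> t * W"
        using B W beta_pos[of t] by (simp add: run_step(3) pos_part_def m_def)
      also have "\<dots> \<le> B / \<beta> (Suc t) * W"
        using inverse_beta_mono[of t "Suc t"] B W by (intro mult_right_mono) (auto simp: divide_inverse)
      finally show "\<mu> (Suc t) $ i $ k \<le> B / \<beta> (Suc t) * w (Suc t) $ i" by (simp add: W_def)
    qed
  qed
  show thesis using that[of B] B bound mix_bound by blast
qed

lemma mu_bounded:
  obtains B where "B > 0" "\<And>t i. norm (\<mu> t $ i) \<le> B / \<beta> t * w t $ i" "\<And>t i. norm (\<nu> t i) \<le> B / \<beta> t"
proof -
  obtain B where B: "B > 0" "\<And>t i k. \<mu> t $ i $ k \<le> B / \<beta> t * w t $ i"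
    "\<And>t i k. mix (A t) (\<mu> t) $ i $ k \<le> B / \<beta> t * w (Suc t) $ i"
    by (rule mu_componentwise_bounded) blast
  define m where "m = real CARD('m)"
  have "norm (\<mu> t $ i) \<le> (m * B) / \<beta> t * w t $ i" for t i
  proof -
    have "norm (\<mu> t $ i) \<le> (\<Sum>k\<in>UNIV. \<bar>\<mu> t $ i $ k\<bar>)" by (rule norm_le_l1_cart)
    also have "\<dots> \<le> (\<Sum>k\<in>(UNIV::'m set). B / \<beta> t * w t $ i)"
      using B(2) mu_nonneg by (intro sum_mono) (metis abs_of_nonneg)
    finally show ?thesis by (simp add: m_def)
  qed
  moreover have "norm (\<nu> t i) \<le> (m * B) / \<beta> t" for t i
  proof -
    have "norm (\<nu> t i) \<le> (\<Sum>k\<in>UNIV. \<bar>\<nu> t i $ k\<bar>)" by (rule norm_le_l1_cart)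
    also have "\<dots> \<le> (\<Sum>k\<in>(UNIV::'m set). B / \<beta> t)"
    proof (rule sum_mono)
      fix k
      have "w (Suc t) $ i * \<nu> t i $ k \<le> w (Suc t) $ i * (B / \<beta> t)"
        using B(3)[of t i k] by (simp add: mix_mu mult.commute)
      then have "\<nu> t i $ k \<le> B / \<beta> t" by (rule mult_left_le_imp_le[OF _ w_pos])
      then show "\<bar>\<nu> t i $ k\<bar> \<le> B / \<beta> t" using nu_nonneg[of t i k] by simp
    qed
    finally show ?thesis by (simp add: m_def)
  qed
  moreover have "m * B > 0" using B by (simp add: m_def)
  ultimately show thesis using that by blast
qed

text \<open>The factor \<open>\<beta>\<close> of the regularization cancels the growth
  \<open>1 / \<beta>\<close> of the multipliers, so dual increments are of order
  \<open>\<alpha>\<close> alone.\<close>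

lemma dual_direction_bounded:
  obtains K where "K > 0" "\<And>t i. norm (Y t i - \<beta> t *\<^sub>R mix (A t) (\<mu> t) $ i) \<le> K"
proof -
  obtain By where By: "By > 0" "\<And>t i. norm (Y t i) \<le> By" by (rule Y_bounded) blast
  obtain B where B: "B > 0" "\<And>t i. norm (\<nu> t i) \<le> B / \<beta> t" by (rule mu_bounded) blast
  have "norm (Y t i - \<beta> t *\<^sub>R mix (A t) (\<mu> t) $ i) \<le> By + n_agents * B" for t i
  proof -
    have "norm (\<beta> t *\<^sub>R mix (A t) (\<mu> t) $ i) = \<beta> t * (w (Suc t) $ i * norm (\<nu> t i))"
      unfolding mix_mu using beta_pos[of t] w_pos[of "Suc t" i] by simp
    also have "\<dots> \<le> \<beta> t * (n_agents * (B / \<beta> t))"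
      using beta_pos[of t] n_agents_ge_1 by (intro mult_left_mono mult_mono w_le B) auto
    also have "\<dots> = n_agents * B" using beta_pos[of t] by simp
    finally show ?thesis by (intro norm_triangle_le_diff add_mono By)
  qed
  moreover have "By + n_agents * B > 0" using By B n_agents_ge_1 by (intro add_pos_pos) auto
  ultimately show thesis using that by blast
qed

lemma s_bounded: obtains B where "B > 0" "\<And>t i. norm (s (Suc t) $ i) \<le> B / \<beta> t"
proof -
  obtain Bg where Bg: "Bg > 0"
    "\<And>i u H k. u \<in> X i \<Longrightarrow> H \<in> subdiff_mat (coord_space (D i)) (g i) u \<Longrightarrow> norm (column k H) \<le> Bg"
    by (rule g_bounds) blast
  obtain B where B: "B > 0" "\<And>t i. norm (\<nu> t i) \<le> B / \<beta> t" by (rule mu_bounded) blast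
  define m where "m = real CARD('m)"
  have "norm (s (Suc t) $ i) \<le> (C_f + m * (B * Bg)) / \<beta> t" for t i
  proof -
    obtain u H where u: "u \<in> subdiff (coord_space (D i)) (f i t) (x t $ i)"
      and H: "H \<in> subdiff_mat (coord_space (D i)) (g i) (x t $ i)"
      and s: "s (Suc t) $ i = u + H *v \<nu> t i" using run_step(1) by blast
    have "norm u \<le> C_f" by (rule f_subgradient[OF x_in u])
    also have "C_f \<le> C_f / \<beta> t"
      using C_f_pos beta_pos[of t] beta_le_1[of t] by (simp add: pos_le_divide_eq mult_left_le)
    finally have 1: "norm u \<le> C_f / \<beta> t" .
    have "norm (H *v \<nu> t i) \<le> (\<Sum>k\<in>UNIV. norm (\<nu> t i $ k *s column k H))"
      unfolding matrix_mult_sum by (rule norm_sum)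
    also have "\<dots> \<le> (\<Sum>k\<in>(UNIV::'m set). B / \<beta> t * Bg)"
      using Bg B beta_pos[of t] unfolding scalar_mult_eq_scaleR norm_scaleR
      by (intro sum_mono mult_mono Bg(2)[OF x_in H] order.trans[OF component_le_norm_cart[unfolded real_norm_def] B(2)]) auto
    finally have "norm (H *v \<nu> t i) \<le> m * (B * Bg) / \<beta> t" by (simp add: m_def)
    with 1 show ?thesis unfolding s by (intro norm_triangle_le) (simp add: add_divide_distrib)
  qed
  moreover have "C_f + m * (B * Bg) > 0" using C_f_pos B Bg by (simp add: m_def add_pos_nonneg)
  ultimately show thesis using that by blast
qed

lemma x_move_le: "norm (x (Suc t) $ i - x t $ i) \<le> \<alpha> t * norm (s (Suc t) $ i)"
proof -
  have "dist (x (Suc t) $ i) (closest_point (X i) (x t $ i)) \<le> dist (x t $ i - \<alpha> t *\<^sub>R s (Suc t) $ i) (x t $ i)"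
    unfolding run_step(2) using x_in[of t i] compact_X convex_X
    by (intro closest_point_lipschitz) (auto simp: compact_imp_closed)
  then show ?thesis using alpha_pos[of t] by (simp add: closest_point_self x_in dist_norm)
qed

lemma g_move_le: obtains B where "B > 0"
  "\<And>t i. norm (g i (x (Suc t) $ i) - g i (x t $ i)) \<le> B * (\<alpha> t / \<beta> t)"
proof -
  obtain Bg where Bg: "Bg > 0"
    "\<And>i u H k. u \<in> X i \<Longrightarrow> H \<in> subdiff_mat (coord_space (D i)) (g i) u \<Longrightarrow> norm (column k H) \<le> Bg"
    by (rule g_bounds) blast
  obtain B where B: "B > 0" "\<And>t i. norm (s (Suc t) $ i) \<le> B / \<beta> t" by (rule s_bounded) blast
  \<comment> \<open>The run itself supplies a subgradient at each iterate. Using one at either end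
    of a move gives both signs of the Lipschitz estimate.\<close>
  have grad: "g i z $ k - g i (x t $ i) $ k \<ge> - Bg * norm (z - x t $ i)" if "z \<in> X i" for i k t z
  proof -
    obtain H where H: "H \<in> subdiff_mat (coord_space (D i)) (g i) (x t $ i)"
      using run_step(1) by blast
    have "g i z $ k - g i (x t $ i) $ k \<ge> column k H \<bullet> (z - x t $ i)"
      using H that X_sub by (auto simp: subdiff_mat_def subdiff_def algebra_simps)
    moreover have "\<bar>column k H \<bullet> (z - x t $ i)\<bar> \<le> Bg * norm (z - x t $ i)"
      by (rule order.trans[OF Cauchy_Schwarz_ineq2]) (intro mult_right_mono Bg(2)[OF x_in H], simp)
    ultimately show ?thesis by simp
  qed
  have "norm (g i (x (Suc t) $ i) - g i (x t $ i)) \<le> (real CARD('m) * Bg * B) * (\<alpha> t / \<beta> t)" for t i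
  proof -
    have "norm (g i (x (Suc t) $ i) - g i (x t $ i))
        \<le> (\<Sum>k\<in>UNIV. \<bar>(g i (x (Suc t) $ i) - g i (x t $ i)) $ k\<bar>)" by (rule norm_le_l1_cart)
    also have "\<dots> \<le> (\<Sum>k\<in>(UNIV::'m set). Bg * norm (x (Suc t) $ i - x t $ i))"
    proof (rule sum_mono)
      fix k
      show "\<bar>(g i (x (Suc t) $ i) - g i (x t $ i)) $ k\<bar> \<le> Bg * norm (x (Suc t) $ i - x t $ i)"
        using grad[where z="x (Suc t) $ i" and i=i and k=k and t=t] grad[where z="x t $ i" and i=i and k=k and t="Suc t"] x_in
        by (auto simp: norm_minus_commute abs_le_iff)
    qed
    also have "\<dots> \<le> (\<Sum>k\<in>(UNIV::'m set). Bg * (\<alpha> t * (B / \<beta> t)))"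
      using Bg alpha_pos[of t]
      by (intro sum_mono mult_left_mono order.trans[OF x_move_le] B(2)) auto
    finally show ?thesis by (simp add: mult_ac)
  qed
  moreover have "real CARD('m) * Bg * B > 0" using B Bg by simp
  ultimately show thesis using that by blast
qed

section \<open>Summed consensus errors\<close>

text \<open>The perturbation of the mixing is the whole clipped dual update, of size at most
  \<open>\<alpha> t * K\<close>, and the initial term vanishes with \<open>\<mu> 0\<close>.\<close>

lemma mu_consensus:
  obtains C where "C > 0" "\<And>T i. 1 \<le> T \<Longrightarrow> (\<Sum>t=1..T. norm (\<nu> t i - \<mu>_mean t)) \<le> C * sqrt (real T)"
proof -
  obtain K where K: "K > 0" "\<And>t i. norm (Y t i - \<beta> t *\<^sub>R mix (A t) (\<mu> t) $ i) \<le> K"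
    by (rule dual_direction_bounded) blast
  obtain C \<rho> where C: "C > 0" "0 < \<rho>" "\<rho> < 1"
    "\<And>(h :: nat \<Rightarrow> (real^'m) ^ 'n) e t i.
       (\<And>t. h (Suc t) = mix (A t) (h t) + e t) \<Longrightarrow>
       norm (mix (A t) (h t) $ i /\<^sub>R w (Suc t) $ i - (\<Sum>j\<in>UNIV. h t $ j) /\<^sub>R n_agents)
         \<le> C * (\<rho> ^ t * (\<Sum>j\<in>UNIV. norm (h 0 $ j)) + (\<Sum>s<t. \<rho> ^ (t - Suc s) * (\<Sum>j\<in>UNIV. norm (e s $ j))))"
    by (rule perturbed_consensus) blast
  define e where "e t = \<mu> (Suc t) - mix (A t) (\<mu> t)" for t
  have e: "(\<Sum>j\<in>UNIV. norm (e t $ j)) \<le> n_agents * K * \<alpha> t" for t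
  proof -
    have "norm (e t $ j) \<le> \<alpha> t * K" for j
    proof -
      have "norm (e t $ j) \<le> norm (\<alpha> t *\<^sub>R (Y t j - \<beta> t *\<^sub>R mix (A t) (\<mu> t) $ j))"
        using norm_pos_part_diff_le[of "mix (A t) (\<mu> t) $ j" "mix (A t) (\<mu> t) $ j + \<alpha> t *\<^sub>R (Y t j - \<beta> t *\<^sub>R mix (A t) (\<mu> t) $ j)"] mix_mu_nonneg
        by (simp add: e_def run_step(3))
      also have "\<dots> \<le> \<alpha> t * K" using K(2)[of t j] alpha_pos[of t] by simp
      finally show ?thesis .
    qed
    then have "(\<Sum>j\<in>UNIV. norm (e t $ j)) \<le> (\<Sum>j\<in>(UNIV::'n set). \<alpha> t * K)" by (rule sum_mono)
    then show ?thesis by (simp add: n_agents_def mult_ac)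
  qed
  have "(\<Sum>t=1..T. norm (\<nu> t i - \<mu>_mean t)) \<le> (C * (n_agents * K) * 3 / (1 - \<rho>)) * sqrt (real T)"
    if T: "1 \<le> T" for T i
  proof -
    have "norm (\<nu> t i - \<mu>_mean t) \<le> C * (n_agents * K) * (\<Sum>s<t. \<rho> ^ (t - Suc s) * \<alpha> s)" for t
    proof -
      have "norm (\<nu> t i - \<mu>_mean t) \<le> C * (\<Sum>s<t. \<rho> ^ (t - Suc s) * (\<Sum>j\<in>UNIV. norm (e s $ j)))"
        using C(4)[of \<mu> e t i] unfolding \<nu>_def \<mu>_mean_def by (simp add: e_def run_init)
      also have "\<dots> \<le> C * (\<Sum>s<t. \<rho> ^ (t - Suc s) * (n_agents * K * \<alpha> s))"
        using C by (intro mult_left_mono sum_mono e) auto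
      finally show ?thesis by (simp add: sum_distrib_left mult_ac)
    qed
    then have "(\<Sum>t=1..T. norm (\<nu> t i - \<mu>_mean t))
        \<le> (\<Sum>t=1..T. C * (n_agents * K) * (\<Sum>s<t. \<rho> ^ (t - Suc s) * \<alpha> s))" by (rule sum_mono)
    also have "\<dots> = C * (n_agents * K) * (\<Sum>t=1..T. \<Sum>s<t. \<rho> ^ (t - Suc s) * \<alpha> s)"
      by (simp add: sum_distrib_left)
    also have "\<dots> \<le> C * (n_agents * K) * ((\<Sum>s<Suc T. \<alpha> s) / (1 - \<rho>))"
      using C K n_agents_ge_1 alpha_pos by (intro mult_left_mono convolution_sum) (auto simp: less_imp_le)
    also have "\<dots> \<le> C * (n_agents * K) * (3 * sqrt (real T) / (1 - \<rho>))"
      using C K n_agents_ge_1 by (intro mult_left_mono divide_right_mono sum_alpha_0 T) auto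
    finally show ?thesis by simp
  qed
  moreover have "C * (n_agents * K) * 3 / (1 - \<rho>) > 0" using C K n_agents_ge_1 by simp
  ultimately show thesis using that by blast
qed

text \<open>Here the primal moves perturb by order \<open>\<alpha> / \<beta>\<close>, with
  \<open>1 / \<beta>\<close> replaced by its last value. The initial term is a convergent geometric
  series and fits in because \<open>sqrt T / \<beta> T\<close> is at least 1.\<close>

lemma y_consensus:
  obtains C where "C > 0"
    "\<And>T i. 1 \<le> T \<Longrightarrow> (\<Sum>t=1..T. norm (Y t i - G t /\<^sub>R n_agents)) \<le> C * (sqrt (real T) / \<beta> T)"
proof -
  obtain K where K: "K > 0" "\<And>t i. norm (g i (x (Suc t) $ i) - g i (x t $ i)) \<le> K * (\<alpha> t / \<beta> t)"
    by (rule g_move_le) blast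
  obtain C \<rho> where C: "C > 0" "0 < \<rho>" "\<rho> < 1"
    "\<And>(h :: nat \<Rightarrow> (real^'m) ^ 'n) e t i.
       (\<And>t. h (Suc t) = mix (A t) (h t) + e t) \<Longrightarrow>
       norm (mix (A t) (h t) $ i /\<^sub>R w (Suc t) $ i - (\<Sum>j\<in>UNIV. h t $ j) /\<^sub>R n_agents)
         \<le> C * (\<rho> ^ t * (\<Sum>j\<in>UNIV. norm (h 0 $ j)) + (\<Sum>s<t. \<rho> ^ (t - Suc s) * (\<Sum>j\<in>UNIV. norm (e s $ j))))"
    by (rule perturbed_consensus) blast
  define S where "S = (\<Sum>j\<in>UNIV. norm (y 0 $ j))"
  have S: "S \<ge> 0" by (simp add: S_def sum_nonneg)
  have e: "(\<Sum>j\<in>UNIV. norm (g j (x (Suc t) $ j) - g j (x t $ j))) \<le> n_agents * K * (\<alpha> t / \<beta> t)" for t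
  proof -
    have "(\<Sum>j\<in>UNIV. norm (g j (x (Suc t) $ j) - g j (x t $ j))) \<le> (\<Sum>j\<in>(UNIV::'n set). K * (\<alpha> t / \<beta> t))"
      by (intro sum_mono K)
    then show ?thesis by (simp add: n_agents_def mult_ac)
  qed
  have "(\<Sum>t=1..T. norm (Y t i - G t /\<^sub>R n_agents)) \<le>
      ((C * S + C * (n_agents * K) * 3) / (1 - \<rho>)) * (sqrt (real T) / \<beta> T)" if T: "1 \<le> T" for T i
  proof -
    have pos: "0 \<le> \<alpha> s / \<beta> s" for s using alpha_pos[of s] beta_pos[of s] by simp
    have "norm (Y t i - G t /\<^sub>R n_agents) \<le> C * S * \<rho> ^ t +
        C * (n_agents * K) * (\<Sum>s<t. \<rho> ^ (t - Suc s) * (\<alpha> s / \<beta> s))" for t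
    proof -
      have "norm (Y t i - G t /\<^sub>R n_agents) \<le> C * (\<rho> ^ t * S +
         (\<Sum>s<t. \<rho> ^ (t - Suc s) * (\<Sum>j\<in>UNIV. norm (g j (x (Suc s) $ j) - g j (x s $ j)))))"
        using C(4)[OF y_perturbed, of t i] unfolding sum_y Y_def S_def by simp
      also have "\<dots> \<le> C * (\<rho> ^ t * S + (\<Sum>s<t. \<rho> ^ (t - Suc s) * (n_agents * K * (\<alpha> s / \<beta> s))))"
        using C by (intro mult_left_mono add_left_mono sum_mono e) auto
      finally show ?thesis by (simp add: sum_distrib_left distrib_left mult_ac)
    qed
    then have "(\<Sum>t=1..T. norm (Y t i - G t /\<^sub>R n_agents)) \<le> (\<Sum>t=1..T. C * S * \<rho> ^ t +
        C * (n_agents * K) * (\<Sum>s<t. \<rho> ^ (t - Suc s) * (\<alpha> s / \<beta> s)))" by (rule sum_mono)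
    also have "\<dots> = C * S * (\<Sum>t=1..T. \<rho> ^ t) +
        C * (n_agents * K) * (\<Sum>t=1..T. \<Sum>s<t. \<rho> ^ (t - Suc s) * (\<alpha> s / \<beta> s))"
      by (simp add: sum.distrib sum_distrib_left)
    also have "\<dots> \<le> C * S * ((sqrt (real T) / \<beta> T) / (1 - \<rho>)) + C * (n_agents * K) * (3 * (sqrt (real T) / \<beta> T) / (1 - \<rho>))"
    proof (intro add_mono mult_left_mono)
      have "(\<Sum>t=1..T. \<rho> ^ t) \<le> (\<Sum>t<Suc T. \<rho> ^ t)" using C by (intro sum_mono2) auto
      also have "\<dots> = (1 - \<rho> ^ Suc T) / (1 - \<rho>)" using C sum_gp_strict[of \<rho> "Suc T"] by simp
      also have "\<dots> \<le> (sqrt (real T) / \<beta> T) / (1 - \<rho>)"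
      proof (intro divide_right_mono)
        have "1 \<le> sqrt (real T) / \<beta> T"
        proof -
          have "1 \<le> sqrt (real T)" using T by simp
          then have "\<beta> T \<le> sqrt (real T)" using beta_le_1[of T] by linarith
          then show ?thesis using beta_pos[of T] by (simp add: pos_le_divide_eq)
        qed
        moreover have "0 \<le> \<rho> ^ Suc T" using C by simp
        ultimately show "1 - \<rho> ^ Suc T \<le> sqrt (real T) / \<beta> T" by linarith
      qed (use C in simp)
      finally show "(\<Sum>t=1..T. \<rho> ^ t) \<le> (sqrt (real T) / \<beta> T) / (1 - \<rho>)" .
    next
      have "(\<Sum>t=1..T. \<Sum>s<t. \<rho> ^ (t - Suc s) * (\<alpha> s / \<beta> s)) \<le> (\<Sum>s<Suc T. \<alpha> s / \<beta> s) / (1 - \<rho>)"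
        using C pos by (intro convolution_sum) auto
      also have "\<dots> \<le> (\<Sum>s<Suc T. \<alpha> s * (1 / \<beta> T)) / (1 - \<rho>)"
      proof (intro divide_right_mono sum_mono)
        fix s assume "s \<in> {..<Suc T}"
        then have "\<alpha> s * (1 / \<beta> s) \<le> \<alpha> s * (1 / \<beta> T)"
          using alpha_pos[of s] by (intro mult_left_mono inverse_beta_mono) auto
        then show "\<alpha> s / \<beta> s \<le> \<alpha> s * (1 / \<beta> T)" by simp
      qed (use C in simp)
      also have "\<dots> = (\<Sum>s<Suc T. \<alpha> s) * (1 / \<beta> T) / (1 - \<rho>)" by (simp only: sum_distrib_right)
      also have "\<dots> \<le> 3 * sqrt (real T) * (1 / \<beta> T) / (1 - \<rho>)"
        using C beta_pos[of T] by (intro divide_right_mono mult_right_mono sum_alpha_0 T) auto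
      finally show "(\<Sum>t=1..T. \<Sum>s<t. \<rho> ^ (t - Suc s) * (\<alpha> s / \<beta> s)) \<le> 3 * (sqrt (real T) / \<beta> T) / (1 - \<rho>)"
        by simp
    qed (use C S K n_agents_ge_1 in auto)
    also have "\<dots> = ((C * S + C * (n_agents * K) * 3) / (1 - \<rho>)) * (sqrt (real T) / \<beta> T)"
      by (simp add: add_divide_distrib distrib_right mult.assoc mult.commute[of "1 - \<rho>"])
    finally show ?thesis .
  qed
  moreover have "(C * S + C * (n_agents * K) * 3) / (1 - \<rho>) > 0"
    using C K S n_agents_ge_1 by (intro divide_pos_pos add_nonneg_pos) auto
  ultimately show thesis using that by blast
qed

section \<open>The Lyapunov inequality\<close>

text \<open>The reference \<open>w p\<close> is the state with all ratios equal to \<open>p\<close>,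
  which mixing reproduces with the new weights.\<close>

definition "drift p t = (\<Sum>i\<in>UNIV. (norm (\<mu> t $ i - w t $ i *\<^sub>R p))\<^sup>2 / w t $ i)"
definition "sqdist t z = (\<Sum>i\<in>UNIV. (norm (x t $ i - z $ i))\<^sup>2)"

text \<open>One projected subgradient step on the Lagrangian with multiplier
  \<open>\<nu> t i\<close>, whose nonnegativity turns the columns of the subgradient matrix into a
  subgradient of the weighted constraint. The projection fixes \<open>z $ i\<close> and is
  nonexpansive.\<close>

lemma primal_step:
  assumes z: "z \<in> stack_set X"
  shows "total_f f t (x t) - total_f f t z + (\<Sum>i\<in>UNIV. \<nu> t i \<bullet> (g i (x t $ i) - g i (z $ i)))
    \<le> (sqdist t z - sqdist (Suc t) z) / (2 * \<alpha> t) + \<alpha> t / 2 * (\<Sum>i\<in>UNIV. (norm (s (Suc t) $ i))\<^sup>2)"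
proof -
  have agent: "2 * \<alpha> t * (f i t (x t $ i) - f i t (z $ i) + \<nu> t i \<bullet> (g i (x t $ i) - g i (z $ i)))
     \<le> (norm (x t $ i - z $ i))\<^sup>2 - (norm (x (Suc t) $ i - z $ i))\<^sup>2 + (\<alpha> t)\<^sup>2 * (norm (s (Suc t) $ i))\<^sup>2" for i
  proof -
    have zi: "z $ i \<in> X i" using z by (simp add: stack_set_def)
    then have ziV: "z $ i \<in> coord_space (D i)" using X_sub by auto
    obtain u H where u: "u \<in> subdiff (coord_space (D i)) (f i t) (x t $ i)"
      and H: "H \<in> subdiff_mat (coord_space (D i)) (g i) (x t $ i)"
      and s: "s (Suc t) $ i = u + H *v \<nu> t i" using run_step(1) by blast
    have uf: "u \<bullet> (z $ i - x t $ i) \<le> f i t (z $ i) - f i t (x t $ i)"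
      using u ziV by (auto simp: subdiff_def algebra_simps)
    have "(H *v \<nu> t i) \<bullet> (z $ i - x t $ i) = (\<Sum>k\<in>UNIV. \<nu> t i $ k * (column k H \<bullet> (z $ i - x t $ i)))"
      by (simp add: matrix_mult_sum scalar_mult_eq_scaleR inner_sum_left)
    also have "\<dots> \<le> (\<Sum>k\<in>UNIV. \<nu> t i $ k * (g i (z $ i) $ k - g i (x t $ i) $ k))"
    proof (intro sum_mono mult_left_mono nu_nonneg)
      fix k
      show "column k H \<bullet> (z $ i - x t $ i) \<le> g i (z $ i) $ k - g i (x t $ i) $ k"
        using H ziV by (auto simp: subdiff_mat_def subdiff_def algebra_simps)
    qed
    also have "\<dots> = \<nu> t i \<bullet> (g i (z $ i) - g i (x t $ i))"
      by (simp add: inner_vec_def)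
    finally have "s (Suc t) $ i \<bullet> (z $ i - x t $ i) \<le>
        f i t (z $ i) - f i t (x t $ i) + \<nu> t i \<bullet> (g i (z $ i) - g i (x t $ i))"
      using uf by (simp add: s inner_add_left)
    then have grad: "f i t (x t $ i) - f i t (z $ i) + \<nu> t i \<bullet> (g i (x t $ i) - g i (z $ i))
        \<le> s (Suc t) $ i \<bullet> (x t $ i - z $ i)"
      by (simp add: inner_diff_right)
    have "dist (x (Suc t) $ i) (closest_point (X i) (z $ i)) \<le> dist (x t $ i - \<alpha> t *\<^sub>R s (Suc t) $ i) (z $ i)"
      unfolding run_step(2) using zi compact_X convex_X
      by (intro closest_point_lipschitz) (auto simp: compact_imp_closed)
    then have "norm (x (Suc t) $ i - z $ i) \<le> norm ((x t $ i - z $ i) - \<alpha> t *\<^sub>R s (Suc t) $ i)"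
      by (simp add: closest_point_self zi dist_norm algebra_simps)
    then have "(norm (x (Suc t) $ i - z $ i))\<^sup>2 \<le> (norm ((x t $ i - z $ i) - \<alpha> t *\<^sub>R s (Suc t) $ i))\<^sup>2"
      by (rule power_mono) simp
    also have "\<dots> = (norm (x t $ i - z $ i))\<^sup>2 - 2 * \<alpha> t * (s (Suc t) $ i \<bullet> (x t $ i - z $ i)) + (\<alpha> t)\<^sup>2 * (norm (s (Suc t) $ i))\<^sup>2"
      unfolding power2_norm_eq_inner
      by (simp add: inner_diff_left inner_diff_right inner_commute power2_eq_square algebra_simps)
    finally show ?thesis
      using mult_left_mono[OF grad, of "2 * \<alpha> t"] alpha_pos[of t] by linarith
  qed
  have "2 * \<alpha> t * (total_f f t (x t) - total_f f t z + (\<Sum>i\<in>UNIV. \<nu> t i \<bullet> (g i (x t $ i) - g i (z $ i))))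
     = (\<Sum>i\<in>UNIV. 2 * \<alpha> t * (f i t (x t $ i) - f i t (z $ i) + \<nu> t i \<bullet> (g i (x t $ i) - g i (z $ i))))"
    by (simp add: total_f_def sum.distrib sum_subtractf flip: sum_distrib_left)
  also have "\<dots> \<le> (\<Sum>i\<in>UNIV. (norm (x t $ i - z $ i))\<^sup>2 - (norm (x (Suc t) $ i - z $ i))\<^sup>2
      + (\<alpha> t)\<^sup>2 * (norm (s (Suc t) $ i))\<^sup>2)" by (rule sum_mono) (rule agent)
  also have "\<dots> = sqdist t z - sqdist (Suc t) z + (\<alpha> t)\<^sup>2 * (\<Sum>i\<in>UNIV. (norm (s (Suc t) $ i))\<^sup>2)"
    by (simp add: sqdist_def sum.distrib sum_subtractf sum_distrib_left)
  finally show ?thesis using alpha_pos[of t] by (simp add: field_simps power2_eq_square)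
qed

text \<open>Clipping does not increase the distance to the nonnegative \<open>w p\<close>. Expand
  the square of the update, divide by the new weight and return to time \<open>t\<close> by
  \<open>mix_perspective\<close>.\<close>

lemma dual_step:
  assumes p: "\<And>k. (p::real^'m) $ k \<ge> 0"
    and K: "\<And>i. norm (Y t i - \<beta> t *\<^sub>R mix (A t) (\<mu> t) $ i) \<le> K"
  shows "- (\<Sum>i\<in>UNIV. (\<nu> t i - p) \<bullet> (Y t i - \<beta> t *\<^sub>R mix (A t) (\<mu> t) $ i))
    \<le> (drift p t - drift p (Suc t)) / (2 * \<alpha> t) + \<alpha> t * (n_agents * K\<^sup>2 / (2 * a ^ period))"
proof -
  define d where "d i = Y t i - \<beta> t *\<^sub>R mix (A t) (\<mu> t) $ i" for i
  define W where "W i = w (Suc t) $ i" for i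
  have W: "W i > 0" "W i \<ge> a ^ period" for i using w_pos w_ge by (auto simp: W_def)
  have agent: "(norm (\<mu> (Suc t) $ i - W i *\<^sub>R p))\<^sup>2 / W i
     \<le> (norm (mix (A t) (\<chi> j. \<mu> t $ j - w t $ j *\<^sub>R p) $ i))\<^sup>2 / W i
        + 2 * \<alpha> t * ((\<nu> t i - p) \<bullet> d i) + (\<alpha> t)\<^sup>2 * (K\<^sup>2 / a ^ period)" for i
  proof -
    \<comment> \<open>The mixed deviation carries a factor \<open>W i\<close>, which cancels on
      division, so the cross terms of all agents enter with equal weight.\<close>
    have mixd: "mix (A t) (\<chi> j. \<mu> t $ j - w t $ j *\<^sub>R p) $ i = W i *\<^sub>R (\<nu> t i - p)"
    proof -
      have "mix (A t) (\<chi> j. \<mu> t $ j - w t $ j *\<^sub>R p) $ i = mix (A t) (\<mu> t) $ i - W i *\<^sub>R p"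
        by (simp add: W_def w_Suc mix_nth scaleR_diff_right sum_subtractf scaleR_sum_left)
      then show ?thesis by (simp add: mix_mu W_def scaleR_diff_right)
    qed
    have "norm (\<mu> (Suc t) $ i - W i *\<^sub>R p) \<le> norm (mix (A t) (\<mu> t) $ i + \<alpha> t *\<^sub>R d i - W i *\<^sub>R p)"
      unfolding run_step(3) d_def using p W(1)[of i] by (intro norm_pos_part_diff_le) simp
    also have "mix (A t) (\<mu> t) $ i + \<alpha> t *\<^sub>R d i - W i *\<^sub>R p = W i *\<^sub>R (\<nu> t i - p) + \<alpha> t *\<^sub>R d i"
      by (simp add: mix_mu W_def scaleR_diff_right)
    finally have "(norm (\<mu> (Suc t) $ i - W i *\<^sub>R p))\<^sup>2 \<le> (norm (W i *\<^sub>R (\<nu> t i - p) + \<alpha> t *\<^sub>R d i))\<^sup>2"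
      by (rule power_mono) simp
    also have "\<dots> = (norm (W i *\<^sub>R (\<nu> t i - p)))\<^sup>2 + 2 * \<alpha> t * W i * ((\<nu> t i - p) \<bullet> d i) + (\<alpha> t)\<^sup>2 * (norm (d i))\<^sup>2"
      unfolding power2_norm_eq_inner
      by (simp add: inner_add_left inner_add_right inner_commute power2_eq_square)
    finally have "(norm (\<mu> (Suc t) $ i - W i *\<^sub>R p))\<^sup>2 / W i \<le>
      ((norm (W i *\<^sub>R (\<nu> t i - p)))\<^sup>2 + 2 * \<alpha> t * W i * ((\<nu> t i - p) \<bullet> d i) + (\<alpha> t)\<^sup>2 * (norm (d i))\<^sup>2) / W i"
      using W(1)[of i] by (intro divide_right_mono) auto
    also have "\<dots> = (norm (W i *\<^sub>R (\<nu> t i - p)))\<^sup>2 / W i + 2 * \<alpha> t * ((\<nu> t i - p) \<bullet> d i) + (\<alpha> t)\<^sup>2 * ((norm (d i))\<^sup>2 / W i)"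
      using W(1)[of i] by (simp add: add_divide_distrib)
    also have "(\<alpha> t)\<^sup>2 * ((norm (d i))\<^sup>2 / W i) \<le> (\<alpha> t)\<^sup>2 * (K\<^sup>2 / a ^ period)"
      using W[of i] K[of i] a_pos by (intro mult_left_mono frac_le power_mono) (auto simp: d_def)
    finally show ?thesis by (simp add: mixd)
  qed
  have "drift p (Suc t) \<le> (\<Sum>i\<in>UNIV. (norm (mix (A t) (\<chi> j. \<mu> t $ j - w t $ j *\<^sub>R p) $ i))\<^sup>2 / W i
        + 2 * \<alpha> t * ((\<nu> t i - p) \<bullet> d i) + (\<alpha> t)\<^sup>2 * (K\<^sup>2 / a ^ period))"
    unfolding drift_def using agent by (intro sum_mono) (simp add: W_def)
  also have "\<dots> = (\<Sum>i\<in>UNIV. (norm (mix (A t) (\<chi> j. \<mu> t $ j - w t $ j *\<^sub>R p) $ i))\<^sup>2 / W i)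
        + 2 * \<alpha> t * (\<Sum>i\<in>UNIV. (\<nu> t i - p) \<bullet> d i) + n_agents * ((\<alpha> t)\<^sup>2 * (K\<^sup>2 / a ^ period))"
    by (simp add: sum.distrib sum_distrib_left n_agents_def)
  also have "(\<Sum>i\<in>UNIV. (norm (mix (A t) (\<chi> j. \<mu> t $ j - w t $ j *\<^sub>R p) $ i))\<^sup>2 / W i) \<le> drift p t"
    using mix_perspective[of t "\<chi> j. \<mu> t $ j - w t $ j *\<^sub>R p"] by (simp add: drift_def W_def)
  finally have "- (2 * \<alpha> t * (\<Sum>i\<in>UNIV. (\<nu> t i - p) \<bullet> d i)) \<le> drift p t - drift p (Suc t)
      + n_agents * ((\<alpha> t)\<^sup>2 * (K\<^sup>2 / a ^ period))" by simp
  then show ?thesis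
    unfolding d_def[symmetric] using alpha_pos[of t] a_pos by (simp add: field_simps power2_eq_square)
qed

lemma mean_nonneg: "\<mu>_mean t $ k \<ge> 0"
  using n_agents_ge_1 by (auto simp: \<mu>_mean_def mu_nonneg intro!: mult_nonneg_nonneg sum_nonneg)

text \<open>The coupling terms of \<open>primal_step\<close> and \<open>dual_step\<close> cancel
  after both have been expressed through the mean multiplier.\<close>

lemma step_inequality:
  obtains K where "K > 0"
    "\<And>t z p. z \<in> feasible_set X g \<Longrightarrow> (\<And>k. (p::real^'m) $ k \<ge> 0) \<Longrightarrow>
      total_f f t (x t) - total_f f t z + p \<bullet> G t \<le>
        1 / (2 * \<alpha> t) * (sqdist t z - sqdist (Suc t) z) + 1 / (2 * \<alpha> t) * (drift p t - drift p (Suc t))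
        + K * (\<alpha> t / (\<beta> t)\<^sup>2) + K * (\<Sum>i\<in>UNIV. norm (\<nu> t i - \<mu>_mean t))
        + (K / \<beta> t + norm p) * (\<Sum>i\<in>UNIV. norm (Y t i - G t /\<^sub>R n_agents)) + K * (\<beta> t * (norm p)\<^sup>2)"
proof -
  obtain Bg where Bg: "Bg > 0" "\<And>i u. u \<in> X i \<Longrightarrow> norm (g i u) \<le> Bg"
    by (rule g_bounds) blast
  obtain BG where BG: "BG > 0" "\<And>t. norm (G t) \<le> BG" by (rule G_bounded) blast
  obtain Bs where Bs: "Bs > 0" "\<And>t i. norm (s (Suc t) $ i) \<le> Bs / \<beta> t" by (rule s_bounded) blast
  obtain Bn where Bn: "Bn > 0" "\<And>t i. norm (\<nu> t i) \<le> Bn / \<beta> t" by (rule mu_bounded) blast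
  obtain Kd where Kd: "Kd > 0" "\<And>t i. norm (Y t i - \<beta> t *\<^sub>R mix (A t) (\<mu> t) $ i) \<le> Kd"
    by (rule dual_direction_bounded) blast
  define c1 where "c1 = n_agents * Bs\<^sup>2 / 2"
  define c2 where "c2 = n_agents * Kd\<^sup>2 / (2 * a ^ period)"
  define K where "K = c1 + c2 + (2 * Bg + BG) + Bn + n_agents * n_agents"
  have pos: "c1 \<ge> 0" "c2 \<ge> 0" "n_agents * n_agents > 0" using n_agents_ge_1 a_pos by (auto simp: c1_def c2_def)
  have "total_f f t (x t) - total_f f t z + p \<bullet> G t \<le>
        1 / (2 * \<alpha> t) * (sqdist t z - sqdist (Suc t) z) + 1 / (2 * \<alpha> t) * (drift p t - drift p (Suc t))
        + K * (\<alpha> t / (\<beta> t)\<^sup>2) + K * (\<Sum>i\<in>UNIV. norm (\<nu> t i - \<mu>_mean t))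
        + (K / \<beta> t + norm p) * (\<Sum>i\<in>UNIV. norm (Y t i - G t /\<^sub>R n_agents)) + K * (\<beta> t * (norm p)\<^sup>2)"
    if z: "z \<in> feasible_set X g" and p: "\<And>k. p $ k \<ge> 0" for t z and p :: "real^'m"
  proof -
    define e where "e = (\<Sum>i\<in>UNIV. norm (\<nu> t i - \<mu>_mean t))"
    define \<epsilon> where "\<epsilon> = (\<Sum>i\<in>UNIV. norm (Y t i - G t /\<^sub>R n_agents))"
    have e0: "e \<ge> 0" "\<epsilon> \<ge> 0" by (auto simp: e_def \<epsilon>_def sum_nonneg)
    have zX: "z \<in> stack_set X" and zg: "\<And>k. total_g g z $ k \<le> 0" using z by (auto simp: feasible_set_def)
    have ab: "\<alpha> t \<le> \<alpha> t / (\<beta> t)\<^sup>2"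
    proof -
      have "(\<beta> t)\<^sup>2 \<le> 1" using beta_pos[of t] beta_le_1[of t] by (simp add: power_le_one)
      then show ?thesis using alpha_pos[of t] beta_pos[of t] by (simp add: pos_le_divide_eq mult_left_le)
    qed
    have s2: "\<alpha> t / 2 * (\<Sum>i\<in>UNIV. (norm (s (Suc t) $ i))\<^sup>2) \<le> c1 * (\<alpha> t / (\<beta> t)\<^sup>2)"
    proof -
      have "(\<Sum>i\<in>UNIV. (norm (s (Suc t) $ i))\<^sup>2) \<le> (\<Sum>i\<in>(UNIV::'n set). (Bs / \<beta> t)\<^sup>2)"
        by (intro sum_mono power_mono Bs) auto
      also have "\<dots> = n_agents * (Bs / \<beta> t)\<^sup>2" by (simp add: n_agents_def)
      finally have "\<alpha> t / 2 * (\<Sum>i\<in>UNIV. (norm (s (Suc t) $ i))\<^sup>2) \<le> \<alpha> t / 2 * (n_agents * (Bs / \<beta> t)\<^sup>2)"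
        using alpha_pos[of t] by (intro mult_left_mono) auto
      then show ?thesis by (simp add: c1_def power_divide mult_ac)
    qed
    \<comment> \<open>The nonnegative \<open>\<mu>_mean t\<close> has nonpositive product with
      feasible constraint values, so the comparator drops out; what remains is consensus
      error.\<close>
    have coupling: "(\<Sum>i\<in>UNIV. \<nu> t i \<bullet> (g i (x t $ i) - g i (z $ i))) \<ge> \<mu>_mean t \<bullet> G t - 2 * Bg * e"
    proof -
      have "(\<Sum>i\<in>UNIV. \<nu> t i \<bullet> (g i (x t $ i) - g i (z $ i)))
        = (\<Sum>i\<in>UNIV. \<mu>_mean t \<bullet> (g i (x t $ i) - g i (z $ i)) + (\<nu> t i - \<mu>_mean t) \<bullet> (g i (x t $ i) - g i (z $ i)))"
        by (simp add: inner_diff_left)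
      also have "\<dots> = \<mu>_mean t \<bullet> G t - \<mu>_mean t \<bullet> total_g g z
          + (\<Sum>i\<in>UNIV. (\<nu> t i - \<mu>_mean t) \<bullet> (g i (x t $ i) - g i (z $ i)))"
        by (simp add: sum.distrib G_def total_g_def inner_sum_right[symmetric] sum_subtractf inner_diff_right)
      finally have eq: "(\<Sum>i\<in>UNIV. \<nu> t i \<bullet> (g i (x t $ i) - g i (z $ i))) = \<dots>" .
      have "\<mu>_mean t \<bullet> total_g g z \<le> 0"
        unfolding inner_vec_def using mean_nonneg zg by (intro sum_nonpos) (auto simp: mult_nonneg_nonpos)
      moreover have "(\<Sum>i\<in>UNIV. (\<nu> t i - \<mu>_mean t) \<bullet> (g i (x t $ i) - g i (z $ i))) \<ge>
          (\<Sum>i\<in>UNIV. - (2 * Bg * norm (\<nu> t i - \<mu>_mean t)))"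
      proof (rule sum_mono)
        fix i
        have "norm (g i (x t $ i) - g i (z $ i)) \<le> Bg + Bg"
          using zX by (intro norm_triangle_le_diff add_mono Bg x_in) (simp add: stack_set_def)
        then have "norm (\<nu> t i - \<mu>_mean t) * norm (g i (x t $ i) - g i (z $ i)) \<le> norm (\<nu> t i - \<mu>_mean t) * (Bg + Bg)"
          by (rule mult_left_mono) simp
        then show "- (2 * Bg * norm (\<nu> t i - \<mu>_mean t)) \<le> (\<nu> t i - \<mu>_mean t) \<bullet> (g i (x t $ i) - g i (z $ i))"
          using Cauchy_Schwarz_ineq2[of "\<nu> t i - \<mu>_mean t" "g i (x t $ i) - g i (z $ i)"] by (simp add: algebra_simps)
      qed
      ultimately show ?thesis unfolding eq by (simp add: e_def sum_distrib_left sum_negf)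
    qed
    have dual: "p \<bullet> G t - \<mu>_mean t \<bullet> G t \<le>
        - (\<Sum>i\<in>UNIV. (\<nu> t i - p) \<bullet> (Y t i - \<beta> t *\<^sub>R mix (A t) (\<mu> t) $ i))
        + BG * e + (Bn / \<beta> t + norm p) * \<epsilon> + n_agents * n_agents * (\<beta> t * (norm p)\<^sup>2)"
    proof -
      \<comment> \<open>\<open>G t\<close> is divided evenly among the agents and each share
        compared with that agent's estimate \<open>Y t i\<close>.\<close>
      have agent: "p \<bullet> (G t /\<^sub>R n_agents) - \<mu>_mean t \<bullet> (G t /\<^sub>R n_agents) \<le>
          - ((\<nu> t i - p) \<bullet> (Y t i - \<beta> t *\<^sub>R mix (A t) (\<mu> t) $ i))
          + BG * norm (\<nu> t i - \<mu>_mean t) + (Bn / \<beta> t + norm p) * norm (Y t i - G t /\<^sub>R n_agents)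
          + n_agents * (\<beta> t * (norm p)\<^sup>2)" for i
      proof -
        define H where "H = G t /\<^sub>R n_agents"
        have H: "norm H \<le> BG"
        proof -
          have "norm H = norm (G t) / n_agents"
            using n_agents_ge_1 by (simp add: H_def divide_inverse mult.commute)
          also have "\<dots> \<le> norm (G t)" using n_agents_ge_1 mult_left_mono[of 1 n_agents "norm (G t)"]
            by (simp add: divide_le_eq)
          finally show ?thesis using BG(2)[of t] by simp
        qed
        have 1: "(\<nu> t i - \<mu>_mean t) \<bullet> H \<le> BG * norm (\<nu> t i - \<mu>_mean t)"
          using norm_cauchy_schwarz[of "\<nu> t i - \<mu>_mean t" H] mult_left_mono[OF H, of "norm (\<nu> t i - \<mu>_mean t)"]
          by (simp add: mult.commute)
        have 2: "(\<nu> t i - p) \<bullet> (Y t i - H) \<le> (Bn / \<beta> t + norm p) * norm (Y t i - H)"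
          by (rule order.trans[OF norm_cauchy_schwarz])
            (intro mult_right_mono norm_triangle_le_diff add_mono Bn order.refl norm_ge_zero)
        have 3: "- ((\<nu> t i - p) \<bullet> (\<beta> t *\<^sub>R mix (A t) (\<mu> t) $ i)) \<le> n_agents * (\<beta> t * (norm p)\<^sup>2)"
        proof -
          define W where "W = w (Suc t) $ i"
          have W: "0 < W" "W \<le> n_agents" using w_pos w_le by (auto simp: W_def)
          \<comment> \<open>Completing the square: the regularization costs only a multiple of
            \<beta> |p|^2, however large the multipliers are.\<close>
          have "0 \<le> (\<nu> t i - (1/2) *\<^sub>R p) \<bullet> (\<nu> t i - (1/2) *\<^sub>R p)" by simp
          also have "\<dots> = (\<nu> t i - p) \<bullet> \<nu> t i + (norm p)\<^sup>2 / 4"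
            by (simp add: inner_diff_left inner_diff_right power2_norm_eq_inner inner_commute algebra_simps)
          finally have "0 \<le> (\<nu> t i - p) \<bullet> \<nu> t i + (norm p)\<^sup>2 / 4" .
          moreover have "0 \<le> (norm p)\<^sup>2" by simp
          ultimately have "- ((\<nu> t i - p) \<bullet> \<nu> t i) \<le> (norm p)\<^sup>2" by linarith
          then have "\<beta> t * W * - ((\<nu> t i - p) \<bullet> \<nu> t i) \<le> \<beta> t * W * (norm p)\<^sup>2"
            using beta_pos[of t] W by (intro mult_left_mono) auto
          also have "\<dots> \<le> \<beta> t * n_agents * (norm p)\<^sup>2"
            using beta_pos[of t] W by (intro mult_left_mono mult_right_mono) auto
          finally show ?thesis by (simp add: mix_mu W_def mult_ac)
        qed
        have "(p - \<mu>_mean t) \<bullet> H = - ((\<nu> t i - p) \<bullet> (Y t i - \<beta> t *\<^sub>R mix (A t) (\<mu> t) $ i))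
            + (\<nu> t i - \<mu>_mean t) \<bullet> H + (\<nu> t i - p) \<bullet> (Y t i - H)
            - (\<nu> t i - p) \<bullet> (\<beta> t *\<^sub>R mix (A t) (\<mu> t) $ i)"
          by (simp add: inner_diff_left inner_diff_right)
        with 1 2 3 show ?thesis unfolding H_def[symmetric] inner_diff_left[symmetric] by linarith
      qed
      have "p \<bullet> G t - \<mu>_mean t \<bullet> G t = (\<Sum>i\<in>(UNIV::'n set). p \<bullet> (G t /\<^sub>R n_agents) - \<mu>_mean t \<bullet> (G t /\<^sub>R n_agents))"
        using n_agents_ge_1
        by (simp add: n_agents_def[symmetric] right_diff_distrib mult.assoc[symmetric])
      also have "\<dots> \<le> (\<Sum>i\<in>UNIV. - ((\<nu> t i - p) \<bullet> (Y t i - \<beta> t *\<^sub>R mix (A t) (\<mu> t) $ i))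
          + BG * norm (\<nu> t i - \<mu>_mean t) + (Bn / \<beta> t + norm p) * norm (Y t i - G t /\<^sub>R n_agents)
          + n_agents * (\<beta> t * (norm p)\<^sup>2))" by (rule sum_mono) (rule agent)
      also have "\<dots> = - (\<Sum>i\<in>UNIV. (\<nu> t i - p) \<bullet> (Y t i - \<beta> t *\<^sub>R mix (A t) (\<mu> t) $ i))
        + BG * e + (Bn / \<beta> t + norm p) * \<epsilon> + n_agents * n_agents * (\<beta> t * (norm p)\<^sup>2)"
        by (simp add: sum.distrib sum_negf sum_subtractf sum_distrib_left[symmetric] e_def \<epsilon>_def n_agents_def mult.assoc)
      finally show ?thesis .
    qed
    have "\<alpha> t * c2 \<le> c2 * (\<alpha> t / (\<beta> t)\<^sup>2)"
      using mult_left_mono[OF ab pos(2)] by (simp add: mult.commute)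
    then have "total_f f t (x t) - total_f f t z + p \<bullet> G t \<le>
        (sqdist t z - sqdist (Suc t) z) / (2 * \<alpha> t) + (drift p t - drift p (Suc t)) / (2 * \<alpha> t)
        + (c1 + c2) * (\<alpha> t / (\<beta> t)\<^sup>2) + (2 * Bg + BG) * e + (Bn / \<beta> t + norm p) * \<epsilon>
        + n_agents * n_agents * (\<beta> t * (norm p)\<^sup>2)"
      using primal_step[OF zX, of t] s2 coupling dual dual_step[of p t Kd, OF p Kd(2), folded c2_def]
      unfolding distrib_right by linarith
    also have "\<dots> \<le> (sqdist t z - sqdist (Suc t) z) / (2 * \<alpha> t) + (drift p t - drift p (Suc t)) / (2 * \<alpha> t)
        + K * (\<alpha> t / (\<beta> t)\<^sup>2) + K * e + (K / \<beta> t + norm p) * \<epsilon> + K * (\<beta> t * (norm p)\<^sup>2)"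
      using pos Bg BG Bn n_agents_ge_1 e0 alpha_pos[of t] beta_pos[of t]
      by (intro add_mono mult_right_mono divide_right_mono order.refl) (auto simp: K_def)
    finally show ?thesis by (simp add: e_def \<epsilon>_def)
  qed
  moreover have "K > 0" using pos Bg BG Bn by (simp add: K_def add_nonneg_pos)
  ultimately show thesis using that by blast
qed

section \<open>Summation over time\<close>

text \<open>By \<open>mu_bounded\<close> the numerator has a factor \<open>w\<^sup>2\<close>, which
  absorbs the division. The level \<open>1 / \<beta> T\<close> serves all \<open>t \<le> T\<close>,
  as \<open>abel_sum_le\<close> requires.\<close>

lemma drift_bounded:
  obtains B where "B > 0"
    "\<And>p t T. t \<le> T \<Longrightarrow> drift p t \<le> B * (1 / (\<beta> T)\<^sup>2 + (norm p)\<^sup>2)" "\<And>p t. 0 \<le> drift p t"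
proof -
  obtain Bm where Bm: "Bm > 0" "\<And>t i. norm (\<mu> t $ i) \<le> Bm / \<beta> t * w t $ i" by (rule mu_bounded) blast
  define B where "B = n_agents * n_agents * (2 * (Bm\<^sup>2 + 1))"
  have "drift p t \<le> B * (1 / (\<beta> T)\<^sup>2 + (norm p)\<^sup>2)" if "t \<le> T" for p t T
  proof -
    have "(norm (\<mu> t $ i - w t $ i *\<^sub>R p))\<^sup>2 / w t $ i \<le> n_agents * (2 * (Bm\<^sup>2 + 1)) * (1 / (\<beta> T)\<^sup>2 + (norm p)\<^sup>2)" for i
    proof -
      define W where "W = w t $ i"
      have W: "0 < W" "W \<le> n_agents" using w_pos w_le by (auto simp: W_def)
      define b where "b = 1 / \<beta> T"
      have "norm (\<mu> t $ i) \<le> Bm * (1 / \<beta> t) * W" using Bm(2)[of t i] by (simp add: W_def)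
      also have "\<dots> \<le> Bm * b * W"
        unfolding b_def using Bm W inverse_beta_mono[OF that] by (intro mult_right_mono mult_left_mono) auto
      finally have "norm (\<mu> t $ i - W *\<^sub>R p) \<le> W * (Bm * b + norm p)"
        using norm_triangle_ineq4[of "\<mu> t $ i" "W *\<^sub>R p"] W by (simp add: algebra_simps)
      then have "(norm (\<mu> t $ i - W *\<^sub>R p))\<^sup>2 \<le> (W * (Bm * b + norm p))\<^sup>2" by (rule power_mono) simp
      also have "\<dots> \<le> W\<^sup>2 * (2 * (Bm\<^sup>2 + 1) * (b\<^sup>2 + (norm p)\<^sup>2))"
      proof -
        have "(Bm * b + norm p)\<^sup>2 \<le> 2 * (Bm * b)\<^sup>2 + 2 * (norm p)\<^sup>2"
          using sum_squares_bound[of "Bm * b" "norm p"] by (simp add: power2_sum)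
        also have "\<dots> \<le> 2 * (Bm\<^sup>2 + 1) * (b\<^sup>2 + (norm p)\<^sup>2)"
          by (simp add: algebra_simps power_mult_distrib)
        finally show ?thesis by (simp add: power_mult_distrib mult_left_mono)
      qed
      finally have "(norm (\<mu> t $ i - W *\<^sub>R p))\<^sup>2 / W \<le> W * (2 * (Bm\<^sup>2 + 1) * (b\<^sup>2 + (norm p)\<^sup>2))"
        using W by (simp add: pos_divide_le_eq power2_eq_square mult_ac)
      also have "\<dots> \<le> n_agents * (2 * (Bm\<^sup>2 + 1) * (b\<^sup>2 + (norm p)\<^sup>2))"
        using W by (intro mult_right_mono) auto
      finally show ?thesis by (simp add: W_def b_def power_divide mult.assoc)
    qed
    then have "drift p t \<le> (\<Sum>i\<in>(UNIV::'n set). n_agents * (2 * (Bm\<^sup>2 + 1)) * (1 / (\<beta> T)\<^sup>2 + (norm p)\<^sup>2))"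
      unfolding drift_def by (rule sum_mono)
    then show ?thesis by (simp add: B_def n_agents_def mult.assoc)
  qed
  moreover have "B > 0" using n_agents_ge_1 by (simp add: B_def add_nonneg_pos)
  moreover have "0 \<le> drift p t" for p t
    unfolding drift_def using w_nonneg by (intro sum_nonneg divide_nonneg_nonneg) auto
  ultimately show thesis using that by blast
qed

lemma diameter:
  obtains R where "R > 0" "\<And>i u v. u \<in> X i \<Longrightarrow> v \<in> X i \<Longrightarrow> norm (u - v) \<le> R"
proof -
  have "bounded (\<Union>i. X i)" by (intro bounded_UN) (auto intro: compact_imp_bounded compact_X)
  then obtain b where b: "b > 0" "\<And>i u. u \<in> X i \<Longrightarrow> norm u \<le> b"
    unfolding bounded_pos by blast
  then have "norm (u - v) \<le> b + b" if "u \<in> X i" "v \<in> X i" for i u v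
    using that by (intro norm_triangle_le_diff add_mono) auto
  then show thesis using that[of "b + b"] b(1) by auto
qed

lemma path_variation_nonneg: "path_variation \<alpha> z T \<ge> 0"
  unfolding path_variation_def using alpha_pos
  by (intro sum_nonneg mult_nonneg_nonneg) (auto simp: less_imp_le)

text \<open>Exchanging \<open>z t\<close> for \<open>z (Suc t)\<close> in the squared distance costs
  at most \<open>2 * r\<close> times the move, with \<open>r\<close> the diameter bound; after
  division by \<open>2 * \<alpha> t\<close> this sums to the path variation. The rest is summed by
  parts.\<close>

lemma primal_telescope:
  obtains R where "R > 0"
    "\<And>T z. 1 \<le> T \<Longrightarrow> (\<And>t. z t \<in> stack_set X) \<Longrightarrow>
      (\<Sum>t=1..T. 1 / (2 * \<alpha> t) * (sqdist t (z t) - sqdist (Suc t) (z t)))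
        \<le> R * sqrt (real T) + R * path_variation \<alpha> z T"
proof -
  obtain r where r: "r > 0" "\<And>i u v. u \<in> X i \<Longrightarrow> v \<in> X i \<Longrightarrow> norm (u - v) \<le> r"
    by (rule diameter) blast
  have "(\<Sum>t=1..T. 1 / (2 * \<alpha> t) * (sqdist t (z t) - sqdist (Suc t) (z t)))
        \<le> (n_agents * r\<^sup>2 + r) * sqrt (real T) + (n_agents * r\<^sup>2 + r) * path_variation \<alpha> z T"
    if T: "1 \<le> T" and z: "\<And>t. z t \<in> stack_set X" for T z
  proof -
    have dist_le: "norm (x t $ i - z t' $ i) \<le> r" for t t' i
      using z x_in by (intro r(2)) (auto simp: stack_set_def)
    define W where "W t = sqdist t (z t)" for t
    have move: "sqdist (Suc t) (z (Suc t)) - sqdist (Suc t) (z t) \<le> 2 * r * (\<Sum>i\<in>UNIV. norm (z (t + 1) $ i - z t $ i))" for t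
    proof -
      have "(norm (x (Suc t) $ i - z (Suc t) $ i))\<^sup>2 - (norm (x (Suc t) $ i - z t $ i))\<^sup>2
          \<le> 2 * r * norm (z (t + 1) $ i - z t $ i)" for i
      proof -
        define P where "P = norm (x (Suc t) $ i - z (Suc t) $ i)"
        define P' where "P' = norm (x (Suc t) $ i - z t $ i)"
        have PP: "0 \<le> P" "P \<le> r" "0 \<le> P'" "P' \<le> r" using dist_le by (auto simp: P_def P'_def)
        have diff: "P - P' \<le> norm (z (t + 1) $ i - z t $ i)"
          using norm_triangle_ineq2[of "x (Suc t) $ i - z (Suc t) $ i" "x (Suc t) $ i - z t $ i"]
          by (simp add: P_def P'_def norm_minus_commute)
        have "P\<^sup>2 - P'\<^sup>2 = (P + P') * (P - P')" by (simp add: power2_eq_square algebra_simps)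
        also have "\<dots> \<le> (P + P') * norm (z (t + 1) $ i - z t $ i)" using diff PP by (intro mult_left_mono) auto
        also have "\<dots> \<le> 2 * r * norm (z (t + 1) $ i - z t $ i)" using PP by (intro mult_right_mono) auto
        finally show ?thesis by (simp add: P_def P'_def)
      qed
      then have "(\<Sum>i\<in>UNIV. (norm (x (Suc t) $ i - z (Suc t) $ i))\<^sup>2 - (norm (x (Suc t) $ i - z t $ i))\<^sup>2)
          \<le> (\<Sum>i\<in>UNIV. 2 * r * norm (z (t + 1) $ i - z t $ i))" by (rule sum_mono)
      then show ?thesis by (simp add: sqdist_def sum_subtractf sum_distrib_left)
    qed
    have "(\<Sum>t=1..T. 1 / (2 * \<alpha> t) * (sqdist t (z t) - sqdist (Suc t) (z t))) \<le>
        (\<Sum>t=1..T. 1 / (2 * \<alpha> t) * (W t - W (Suc t)) + r * (1 / \<alpha> t * (\<Sum>i\<in>UNIV. norm (z (t + 1) $ i - z t $ i))))"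
    proof (rule sum_mono)
      fix t
      have "1 / (2 * \<alpha> t) * (sqdist t (z t) - sqdist (Suc t) (z t)) =
          1 / (2 * \<alpha> t) * (W t - W (Suc t)) + 1 / (2 * \<alpha> t) * (sqdist (Suc t) (z (Suc t)) - sqdist (Suc t) (z t))"
        by (simp add: W_def algebra_simps)
      also have "1 / (2 * \<alpha> t) * (sqdist (Suc t) (z (Suc t)) - sqdist (Suc t) (z t)) \<le>
          1 / (2 * \<alpha> t) * (2 * r * (\<Sum>i\<in>UNIV. norm (z (t + 1) $ i - z t $ i)))"
        using alpha_pos[of t] by (intro mult_left_mono move) auto
      finally show "1 / (2 * \<alpha> t) * (sqdist t (z t) - sqdist (Suc t) (z t)) \<le>
          1 / (2 * \<alpha> t) * (W t - W (Suc t)) + r * (1 / \<alpha> t * (\<Sum>i\<in>UNIV. norm (z (t + 1) $ i - z t $ i)))" by simp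
    qed
    also have "\<dots> = (\<Sum>t=1..T. 1 / (2 * \<alpha> t) * (W t - W (Suc t))) + r * path_variation \<alpha> z T"
      by (simp add: sum.distrib path_variation_def sum_distrib_left)
    also have "(\<Sum>t=1..T. 1 / (2 * \<alpha> t) * (W t - W (Suc t))) \<le> 1 / (2 * \<alpha> T) * (n_agents * r\<^sup>2)"
    proof (rule abel_sum_le[OF _ _ _ T])
      show "W t \<le> n_agents * r\<^sup>2" for t
      proof -
        have "W t \<le> (\<Sum>i\<in>(UNIV::'n set). r\<^sup>2)" unfolding W_def sqdist_def
          by (intro sum_mono power_mono dist_le) auto
        then show ?thesis by (simp add: n_agents_def)
      qed
    qed (auto simp: alpha W_def sqdist_def sum_nonneg)
    also have "\<dots> \<le> (n_agents * r\<^sup>2) * sqrt (real T)"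
      using T r n_agents_ge_1 by (simp add: alpha mult.commute mult_left_le)
    finally have "(\<Sum>t=1..T. 1 / (2 * \<alpha> t) * (sqdist t (z t) - sqdist (Suc t) (z t)))
        \<le> (n_agents * r\<^sup>2) * sqrt (real T) + r * path_variation \<alpha> z T" by simp
    also have "\<dots> \<le> (n_agents * r\<^sup>2 + r) * sqrt (real T) + (n_agents * r\<^sup>2 + r) * path_variation \<alpha> z T"
      using r n_agents_ge_1 by (intro add_mono mult_right_mono path_variation_nonneg) auto
    finally show ?thesis .
  qed
  moreover have "n_agents * r\<^sup>2 + r > 0" using r n_agents_ge_1 by (intro add_nonneg_pos) auto
  ultimately show thesis using that by blast
qed

lemma sum_beta: "1 \<le> T \<Longrightarrow> (\<Sum>t=1..T. \<beta> t) \<le> 2 * real T powr (1 - \<kappa>)"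
proof -
  assume T: "1 \<le> T"
  have "(\<Sum>t=1..T. \<beta> t) \<le> real T powr (1 - \<kappa>) / (1 - \<kappa>)"
    using sum_powr_le[of \<kappa> T] kappa by (simp add: beta)
  also have "\<dots> \<le> real T powr (1 - \<kappa>) / (1 / 2)" using kappa by (intro divide_left_mono) auto
  finally show ?thesis by simp
qed

text \<open>Lets the |p|^2 terms from drift and tracking be absorbed by that of the
  regularization.\<close>

lemma sqrt_le_powr: "1 \<le> T \<Longrightarrow> sqrt (real T) \<le> real T powr (1 - \<kappa>)"
  using kappa by (auto simp: powr_half_sqrt[symmetric] intro!: powr_mono)

lemma sqrt_beta: "1 \<le> T \<Longrightarrow> sqrt (real T) / (\<beta> T)\<^sup>2 = real T powr (1 / 2 + 2 * \<kappa>)"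
proof -
  assume T: "1 \<le> T"
  have "1 / (\<beta> T)\<^sup>2 = (real T powr \<kappa>)\<^sup>2" using T by (simp add: beta power_divide)
  also have "\<dots> = real T powr (2 * \<kappa>)" by (simp add: power2_eq_square flip: powr_add)
  finally have "sqrt (real T) * (1 / (\<beta> T)\<^sup>2) = real T powr (1 / 2) * real T powr (2 * \<kappa>)"
    using T by (simp add: powr_half_sqrt)
  then show ?thesis by (simp add: powr_add)
qed

lemma regret_inequality:
  obtains K where "K > 0"
    "\<And>T z p. 1 \<le> T \<Longrightarrow> (\<And>t. z t \<in> feasible_set X g) \<Longrightarrow> (\<And>k. (p::real^'m) $ k \<ge> 0) \<Longrightarrow>
      (\<Sum>t=1..T. total_f f t (x t) - total_f f t (z t)) + p \<bullet> (\<Sum>t=1..T. G t) \<le>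
        K * path_variation \<alpha> z T + K * real T powr (1 / 2 + 2 * \<kappa>) + K * real T powr (1 - \<kappa>) * (norm p)\<^sup>2"
proof -
  obtain K where K: "K > 0"
    "\<And>t z p. z \<in> feasible_set X g \<Longrightarrow> (\<And>k. (p::real^'m) $ k \<ge> 0) \<Longrightarrow>
      total_f f t (x t) - total_f f t z + p \<bullet> G t \<le>
        1 / (2 * \<alpha> t) * (sqdist t z - sqdist (Suc t) z) + 1 / (2 * \<alpha> t) * (drift p t - drift p (Suc t))
        + K * (\<alpha> t / (\<beta> t)\<^sup>2) + K * (\<Sum>i\<in>UNIV. norm (\<nu> t i - \<mu>_mean t))
        + (K / \<beta> t + norm p) * (\<Sum>i\<in>UNIV. norm (Y t i - G t /\<^sub>R n_agents)) + K * (\<beta> t * (norm p)\<^sup>2)"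
    by (rule step_inequality) blast
  obtain B where B: "B > 0" "\<And>p t T. t \<le> T \<Longrightarrow> drift p t \<le> B * (1 / (\<beta> T)\<^sup>2 + (norm p)\<^sup>2)" "\<And>p t. 0 \<le> drift p t"
    by (rule drift_bounded) blast
  obtain R where R: "R > 0" "\<And>T z. 1 \<le> T \<Longrightarrow> (\<And>t. z t \<in> stack_set X) \<Longrightarrow>
      (\<Sum>t=1..T. 1 / (2 * \<alpha> t) * (sqdist t (z t) - sqdist (Suc t) (z t)))
        \<le> R * sqrt (real T) + R * path_variation \<alpha> z T" by (rule primal_telescope) blast
  obtain Cm where Cm: "Cm > 0" "\<And>T i. 1 \<le> T \<Longrightarrow> (\<Sum>t=1..T. norm (\<nu> t i - \<mu>_mean t)) \<le> Cm * sqrt (real T)"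
    by (rule mu_consensus) blast
  obtain Cy where Cy: "Cy > 0"
    "\<And>T i. 1 \<le> T \<Longrightarrow> (\<Sum>t=1..T. norm (Y t i - G t /\<^sub>R n_agents)) \<le> Cy * (sqrt (real T) / \<beta> T)"
    by (rule y_consensus) blast
  \<comment> \<open>Apart from the path variation and the regularization, every error term is at
    most a multiple of \<open>S * (b\<^sup>2 + P)\<close>, and \<open>L\<close> collects the
    factors. The regularization adds \<open>K * 2\<close>.\<close>
  define L where "L = R + B + K * 2 + K * (n_agents * Cm) + (K + 1) * (n_agents * Cy)"
  have L: "L \<ge> 0" using R B K Cm Cy n_agents_ge_1 by (auto simp: L_def)
  have "(\<Sum>t=1..T. total_f f t (x t) - total_f f t (z t)) + p \<bullet> (\<Sum>t=1..T. G t) \<le>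
        (L + K * 2) * path_variation \<alpha> z T + (L + K * 2) * real T powr (1 / 2 + 2 * \<kappa>)
        + (L + K * 2) * real T powr (1 - \<kappa>) * (norm p)\<^sup>2"
    if T: "1 \<le> T" and z: "\<And>t. z t \<in> feasible_set X g" and p: "\<And>k. p $ k \<ge> 0" for T z and p :: "real^'m"
  proof -
    define S where "S = sqrt (real T)"
    define b where "b = 1 / \<beta> T"
    define P where "P = (norm p)\<^sup>2"
    have S: "S \<ge> 0" and P: "P \<ge> 0" by (auto simp: S_def P_def)
    have b: "b \<ge> 1" unfolding b_def using beta_pos[of T] beta_le_1[of T] by simp
    then have b2: "1 \<le> b\<^sup>2" by (simp add: one_le_power)
    define D where "D t = (\<Sum>i\<in>UNIV. norm (Y t i - G t /\<^sub>R n_agents))" for t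
    have sum_drift: "(\<Sum>t=1..T. 1 / (2 * \<alpha> t) * (drift p t - drift p (Suc t))) \<le> B * (S * (b\<^sup>2 + P))"
    proof -
      have "(\<Sum>t=1..T. 1 / (2 * \<alpha> t) * (drift p t - drift p (Suc t))) \<le> 1 / (2 * \<alpha> T) * (B * (1 / (\<beta> T)\<^sup>2 + (norm p)\<^sup>2))"
        by (rule abel_sum_le[OF _ _ B(3) T B(2)]) (auto simp: alpha)
      also have "\<dots> \<le> S * (B * (b\<^sup>2 + P))"
        unfolding b_def P_def S_def power_divide using T B(1) by (intro mult_mono) (auto simp: alpha)
      finally show ?thesis by (simp add: mult_ac)
    qed
    have sum_ab: "(\<Sum>t=1..T. \<alpha> t / (\<beta> t)\<^sup>2) \<le> 2 * (S * b\<^sup>2)"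
    proof -
      have "(\<Sum>t=1..T. \<alpha> t / (\<beta> t)\<^sup>2) \<le> (\<Sum>t=1..T. \<alpha> t * b\<^sup>2)"
      proof (rule sum_mono)
        fix t assume "t \<in> {1..T}"
        then have "(1 / \<beta> t)\<^sup>2 \<le> b\<^sup>2"
          unfolding b_def using beta_pos[of t] by (intro power_mono inverse_beta_mono) auto
        then have "\<alpha> t * (1 / \<beta> t)\<^sup>2 \<le> \<alpha> t * b\<^sup>2" using alpha_pos[of t] by (intro mult_left_mono) auto
        then show "\<alpha> t / (\<beta> t)\<^sup>2 \<le> \<alpha> t * b\<^sup>2" by (simp add: power_divide)
      qed
      also have "\<dots> = (\<Sum>t=1..T. \<alpha> t) * b\<^sup>2" by (simp add: sum_distrib_right)
      also have "\<dots> \<le> 2 * S * b\<^sup>2" unfolding S_def by (intro mult_right_mono sum_alpha T) auto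
      finally show ?thesis by simp
    qed
    have sum_mu: "(\<Sum>t=1..T. \<Sum>i\<in>UNIV. norm (\<nu> t i - \<mu>_mean t)) \<le> n_agents * Cm * (S * b\<^sup>2)"
    proof -
      have "(\<Sum>t=1..T. \<Sum>i\<in>UNIV. norm (\<nu> t i - \<mu>_mean t)) = (\<Sum>i\<in>UNIV. \<Sum>t=1..T. norm (\<nu> t i - \<mu>_mean t))"
        by (rule sum.swap)
      also have "\<dots> \<le> (\<Sum>i\<in>(UNIV::'n set). Cm * S)" unfolding S_def by (intro sum_mono Cm T)
      also have "\<dots> = n_agents * Cm * (S * 1)" by (simp add: n_agents_def)
      also have "\<dots> \<le> n_agents * Cm * (S * b\<^sup>2)"
        using n_agents_ge_1 Cm S b2 by (intro mult_left_mono) auto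
      finally show ?thesis .
    qed
    have sum_D: "(\<Sum>t=1..T. D t) \<le> n_agents * Cy * (S * b)"
    proof -
      have "(\<Sum>t=1..T. D t) = (\<Sum>i\<in>UNIV. \<Sum>t=1..T. norm (Y t i - G t /\<^sub>R n_agents))"
        unfolding D_def by (rule sum.swap)
      also have "\<dots> \<le> (\<Sum>i\<in>(UNIV::'n set). Cy * (S / \<beta> T))" unfolding S_def by (intro sum_mono Cy T)
      also have "\<dots> = n_agents * Cy * (S * b)" by (simp add: n_agents_def b_def)
      finally show ?thesis .
    qed
    have D0: "D t \<ge> 0" for t by (simp add: D_def sum_nonneg)
    have sum_y: "(\<Sum>t=1..T. (K / \<beta> t + norm p) * D t) \<le> (K + 1) * (n_agents * Cy) * (S * (b\<^sup>2 + P))"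
    proof -
      have "(\<Sum>t=1..T. (K / \<beta> t + norm p) * D t) \<le> (\<Sum>t=1..T. (K * b + norm p) * D t)"
      proof (intro sum_mono mult_right_mono D0 add_right_mono)
        fix t assume "t \<in> {1..T}"
        then show "K / \<beta> t \<le> K * b" unfolding b_def
          using mult_left_mono[OF inverse_beta_mono[of t T], of K] K by simp
      qed
      also have "\<dots> = (K * b + norm p) * (\<Sum>t=1..T. D t)" by (simp add: sum_distrib_left)
      also have "\<dots> \<le> (K * b + norm p) * (n_agents * Cy * (S * b))"
        using K b by (intro mult_left_mono sum_D) auto
      also have "\<dots> = (n_agents * Cy * S) * (K * b\<^sup>2 + norm p * b)" by (simp add: algebra_simps power2_eq_square)
      \<comment> \<open>The mixed term \<open>norm p * b\<close> is shared between
        \<open>b\<^sup>2\<close> and \<open>P\<close> by completing a square.\<close>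
      also have "\<dots> \<le> (n_agents * Cy * S) * ((K + 1) * (b\<^sup>2 + P))"
      proof (intro mult_left_mono)
        have "norm p * b \<le> b\<^sup>2 + P"
        proof -
          have "2 * (norm p * b) \<le> b\<^sup>2 + P" using sum_squares_bound[of "norm p" b] by (simp add: P_def)
          moreover have "0 \<le> norm p * b" using b by simp
          ultimately show ?thesis by linarith
        qed
        moreover have "0 \<le> K * P" using K P by simp
        ultimately show "K * b\<^sup>2 + norm p * b \<le> (K + 1) * (b\<^sup>2 + P)" by (simp add: algebra_simps)
      qed (use n_agents_ge_1 Cy S in auto)
      finally show ?thesis by (simp add: mult_ac)
    qed
    have zX: "z t \<in> stack_set X" for t using z by (simp add: feasible_set_def)
    have pv: "path_variation \<alpha> z T \<ge> 0" by (rule path_variation_nonneg)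
    have "(\<Sum>t=1..T. total_f f t (x t) - total_f f t (z t)) + p \<bullet> (\<Sum>t=1..T. G t)
      = (\<Sum>t=1..T. total_f f t (x t) - total_f f t (z t) + p \<bullet> G t)"
      by (simp add: sum.distrib inner_sum_right)
    also have "\<dots> \<le> (\<Sum>t=1..T. 1 / (2 * \<alpha> t) * (sqdist t (z t) - sqdist (Suc t) (z t)) + 1 / (2 * \<alpha> t) * (drift p t - drift p (Suc t))
        + K * (\<alpha> t / (\<beta> t)\<^sup>2) + K * (\<Sum>i\<in>UNIV. norm (\<nu> t i - \<mu>_mean t))
        + (K / \<beta> t + norm p) * D t + K * (\<beta> t * P))"
      unfolding D_def P_def by (intro sum_mono K z p)
    also have "\<dots> = (\<Sum>t=1..T. 1 / (2 * \<alpha> t) * (sqdist t (z t) - sqdist (Suc t) (z t)))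
        + (\<Sum>t=1..T. 1 / (2 * \<alpha> t) * (drift p t - drift p (Suc t)))
        + K * (\<Sum>t=1..T. \<alpha> t / (\<beta> t)\<^sup>2) + K * (\<Sum>t=1..T. \<Sum>i\<in>UNIV. norm (\<nu> t i - \<mu>_mean t))
        + (\<Sum>t=1..T. (K / \<beta> t + norm p) * D t) + K * ((\<Sum>t=1..T. \<beta> t) * P)"
      by (simp only: sum.distrib sum_distrib_left sum_distrib_right)
    also have "\<dots> \<le> (R * S + R * path_variation \<alpha> z T) + B * (S * (b\<^sup>2 + P)) + K * (2 * (S * b\<^sup>2))
        + K * (n_agents * Cm * (S * b\<^sup>2)) + (K + 1) * (n_agents * Cy) * (S * (b\<^sup>2 + P))
        + K * (2 * real T powr (1 - \<kappa>) * P)"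
      using K P R(2)[OF T zX] sum_drift sum_ab sum_mu sum_y sum_beta[OF T] unfolding S_def
      by (intro add_mono mult_left_mono mult_right_mono) auto
    also have "\<dots> \<le> L * path_variation \<alpha> z T + L * (S * (b\<^sup>2 + P)) + K * (2 * real T powr (1 - \<kappa>) * P)"
    proof -
      define V where "V = S * (b\<^sup>2 + P)"
      have V: "S \<le> V" "S * b\<^sup>2 \<le> V" "0 \<le> V"
      proof -
        show "S * b\<^sup>2 \<le> V" "0 \<le> V" unfolding V_def using S P by (auto intro!: mult_left_mono)
        have "S * 1 \<le> S * (b\<^sup>2 + P)" using S P b2 by (intro mult_left_mono) auto
        then show "S \<le> V" by (simp add: V_def)
      qed
      have "R * S \<le> R * V" "K * (2 * (S * b\<^sup>2)) \<le> K * 2 * V"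
        "K * (n_agents * Cm * (S * b\<^sup>2)) \<le> K * (n_agents * Cm) * V"
        using R K Cm n_agents_ge_1 V by auto
      moreover have "R * path_variation \<alpha> z T \<le> L * path_variation \<alpha> z T"
        using B K Cm Cy n_agents_ge_1 pv by (intro mult_right_mono) (auto simp: L_def)
      ultimately show ?thesis unfolding V_def[symmetric] by (simp add: L_def distrib_right)
    qed
    also have "\<dots> \<le> L * path_variation \<alpha> z T + L * (real T powr (1 / 2 + 2 * \<kappa>) + real T powr (1 - \<kappa>) * P)
        + K * (2 * real T powr (1 - \<kappa>) * P)"
    proof -
      have "S * b\<^sup>2 = real T powr (1 / 2 + 2 * \<kappa>)"
        using sqrt_beta[OF T] by (simp add: S_def b_def power_divide)
      moreover have "S * P \<le> real T powr (1 - \<kappa>) * P"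
        unfolding S_def using sqrt_le_powr[OF T] P by (rule mult_right_mono)
      ultimately have "S * (b\<^sup>2 + P) \<le> real T powr (1 / 2 + 2 * \<kappa>) + real T powr (1 - \<kappa>) * P"
        by (simp add: distrib_left)
      from mult_left_mono[OF this L] show ?thesis by simp
    qed
    also have "\<dots> \<le> (L + K * 2) * path_variation \<alpha> z T + (L + K * 2) * real T powr (1 / 2 + 2 * \<kappa>)
        + (L + K * 2) * real T powr (1 - \<kappa>) * P"
      using K pv by (simp add: algebra_simps)
    finally show ?thesis by (simp add: P_def)
  qed
  moreover have "L + K * 2 > 0" using L K by simp
  ultimately show thesis using that by blast
qed

section \<open>Regret and constraint violation\<close>

lemma total_f_bounded:
  assumes "u \<in> stack_set X" shows "\<bar>total_f f t u\<bar> \<le> n_agents * B_f"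
proof -
  have "\<bar>total_f f t u\<bar> \<le> (\<Sum>i\<in>(UNIV::'n set). B_f)"
    unfolding total_f_def using assms
    by (intro order.trans[OF sum_abs] sum_mono f_bounded) (auto simp: stack_set_def)
  then show ?thesis by (simp add: n_agents_def)
qed

lemma x_in_stack: "x t \<in> stack_set X"
  by (simp add: stack_set_def x_in)

lemma regret_upper_bound:
  assumes "\<And>t. xstar t \<in> feasible_set X g"
  shows "\<exists>C1>0. \<exists>C2>0. \<forall>T\<ge>1.
    Reg f x xstar T \<le> C1 * real T powr (1 / 2 + 2 * \<kappa>) + C2 * path_variation \<alpha> xstar T"
proof -
  obtain K where K: "K > 0" "\<And>T z p. 1 \<le> T \<Longrightarrow> (\<And>t. z t \<in> feasible_set X g) \<Longrightarrow> (\<And>k. (p::real^'m) $ k \<ge> 0) \<Longrightarrow>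
      (\<Sum>t=1..T. total_f f t (x t) - total_f f t (z t)) + p \<bullet> (\<Sum>t=1..T. G t) \<le>
        K * path_variation \<alpha> z T + K * real T powr (1 / 2 + 2 * \<kappa>) + K * real T powr (1 - \<kappa>) * (norm p)\<^sup>2"
    by (rule regret_inequality) blast
  have "Reg f x xstar T \<le> K * real T powr (1 / 2 + 2 * \<kappa>) + K * path_variation \<alpha> xstar T" if "1 \<le> T" for T
    using K(2)[where T=T and z=xstar and p=0, OF that assms] by (simp add: Reg_def sum_subtractf)
  then show ?thesis using K(1) by blast
qed

text \<open>The multiplier \<open>p\<close> below maximizes \<open>p \<bullet> S - K T\<^bsup>1-\<kappa>\<^esup> |p|\<^sup>2\<close> over the nonnegative orthant.\<close>

lemma violation_bound:
  assumes "feasible_set X g \<noteq> {}"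
  shows "\<exists>C>0. \<forall>T\<ge>1. Reg_c g x T \<le> C * real T powr (1 - \<kappa> / 2)"
proof -
  obtain K where K: "K > 0" "\<And>T z p. 1 \<le> T \<Longrightarrow> (\<And>t. z t \<in> feasible_set X g) \<Longrightarrow> (\<And>k. (p::real^'m) $ k \<ge> 0) \<Longrightarrow>
      (\<Sum>t=1..T. total_f f t (x t) - total_f f t (z t)) + p \<bullet> (\<Sum>t=1..T. G t) \<le>
        K * path_variation \<alpha> z T + K * real T powr (1 / 2 + 2 * \<kappa>) + K * real T powr (1 - \<kappa>) * (norm p)\<^sup>2"
    by (rule regret_inequality) blast
  obtain z where z: "z \<in> feasible_set X g" using assms by blast
  define M where "M = 4 * K * (K + 2 * (n_agents * B_f))"
  have M: "M > 0" using K n_agents_ge_1 B_f_pos by (auto simp: M_def intro!: mult_pos_pos add_pos_pos)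
  have "Reg_c g x T \<le> sqrt M * real T powr (1 - \<kappa> / 2)" if T: "1 \<le> T" for T
  proof -
    define S where "S = (\<Sum>t=1..T. G t)"
    define q where "q = norm (pos_part S)"
    \<comment> \<open>The critical point of
      \<open>c * q\<^sup>2 - K * T powr (1 - \<kappa>) * (c * q)\<^sup>2\<close>, at which half of
      the linear term survives.\<close>
    define c where "c = 1 / (2 * K * real T powr (1 - \<kappa>))"
    have Tp: "real T powr (1 - \<kappa>) > 0" using T by simp
    have c: "c > 0" using K Tp by (simp add: c_def)
    have inner: "pos_part S \<bullet> S = q\<^sup>2"
      unfolding q_def power2_norm_eq_inner inner_vec_def
      by (rule sum.cong) (auto simp: pos_part_def max_def)
    have "(c *\<^sub>R pos_part S) $ k \<ge> 0" for k using c by (simp add: pos_part_def)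
    from K(2)[OF T z this, folded S_def]
    have "(\<Sum>t=1..T. total_f f t (x t) - total_f f t z) + c * q\<^sup>2
        \<le> K * real T powr (1 / 2 + 2 * \<kappa>) + K * real T powr (1 - \<kappa>) * (c * q)\<^sup>2"
      using c by (simp add: inner path_variation_def q_def)
    also have "K * real T powr (1 - \<kappa>) * (c * q)\<^sup>2 = c * q\<^sup>2 / 2"
      using K Tp by (simp add: c_def power2_eq_square field_simps)
    finally have 1: "(\<Sum>t=1..T. total_f f t (x t) - total_f f t z) + c * q\<^sup>2 / 2 \<le> K * real T powr (1 / 2 + 2 * \<kappa>)"
      by simp
    \<comment> \<open>The regret against \<open>z\<close> may be negative, but by no more than order
      T; this loss fixes the exponent 1 - \<kappa>/2.\<close>
    have "(\<Sum>t=1..T. total_f f t (x t) - total_f f t z) \<ge> (\<Sum>t=1..T. - (2 * (n_agents * B_f)))"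
    proof (rule sum_mono)
      fix t
      have "z \<in> stack_set X" using z by (simp add: feasible_set_def)
      then show "- (2 * (n_agents * B_f)) \<le> total_f f t (x t) - total_f f t z"
        using total_f_bounded[OF x_in_stack, of t t] total_f_bounded[of z t] by linarith
    qed
    then have 2: "(\<Sum>t=1..T. total_f f t (x t) - total_f f t z) \<ge> - (2 * (n_agents * B_f) * real T)"
      by (simp add: mult.commute)
    \<comment> \<open>\<open>\<kappa> < 1 / 4\<close> puts this exponent below 1, so the term joins
      the linear one.\<close>
    have "real T powr (1 / 2 + 2 * \<kappa>) \<le> real T powr 1" using T kappa by (intro powr_mono) auto
    then have "K * real T powr (1 / 2 + 2 * \<kappa>) \<le> K * real T" using K T by simp
    with 1 2 have "c * q\<^sup>2 / 2 \<le> (K + 2 * (n_agents * B_f)) * real T" by (simp add: distrib_right)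
    then have "q\<^sup>2 \<le> M * (real T * real T powr (1 - \<kappa>))"
      using K Tp by (simp add: c_def M_def field_simps)
    also have "real T * real T powr (1 - \<kappa>) = (real T powr (1 - \<kappa> / 2))\<^sup>2"
    proof -
      have "real T * real T powr (1 - \<kappa>) = real T powr (1 + (1 - \<kappa>))" using T powr_add[of "real T" 1 "1 - \<kappa>"] by simp
      also have "1 + (1 - \<kappa>) = (1 - \<kappa> / 2) + (1 - \<kappa> / 2)" by simp
      finally show ?thesis by (simp only: powr_add power2_eq_square)
    qed
    finally have "q \<le> sqrt (M * (real T powr (1 - \<kappa> / 2))\<^sup>2)" by (rule real_le_rsqrt)
    then show ?thesis by (simp add: real_sqrt_mult q_def S_def Reg_c_def G_def)
  qed
  then show ?thesis using M by (intro exI[of _ "sqrt M"]) auto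
qed

text \<open>The gap of one round is linear in its violation, so the gaps add up to the components of
  the accumulated violation. One slack \<open>\<delta>\<close> serves all rounds, whatever their
  costs, which makes the constant uniform.\<close>

lemma regret_lower_bound:
  assumes opt: "\<And>t. is_arg_min (total_f f t) (\<lambda>z. z \<in> feasible_set X g) (xstar t)"
    and slater: "slater D X g"
  shows "\<exists>C>0. \<forall>T\<ge>1. (\<forall>t\<in>{1..T}. \<forall>k. total_g g (x t) $ k > 0) \<longrightarrow> Reg f x xstar T \<ge> - C * Reg_c g x T"
proof (cases "\<forall>k. total_g g (x 1) $ k > 0")
  case False
  \<comment> \<open>The premise fails at round 1 for every \<open>T \<ge> 1\<close>.\<close>
  then show ?thesis by (intro exI[of _ 1]) force
next
  case True
  \<comment> \<open>The first iterate serves as the infeasible point from which the Slater point is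
    moved away.\<close>
  obtain z where z: "z \<in> stack_set X" "\<And>k. total_g g z $ k < 0"
    by (rule strict_slater[OF convex_g X_sub convex_X slater x_in_stack[of 1]]) (use True in auto)
  define \<delta> where "\<delta> = Min (range (\<lambda>k. - total_g g z $ k))"
  have \<delta>: "\<delta> > 0" "total_g g z $ k \<le> - \<delta>" for k
  proof -
    show "\<delta> > 0" unfolding \<delta>_def using z(2) by (subst Min_gr_iff) auto
    have "\<delta> \<le> - total_g g z $ k" unfolding \<delta>_def by (rule Min_le) auto
    then show "total_g g z $ k \<le> - \<delta>" by simp
  qed
  define c where "c = 2 * real CARD('n) * B_f / \<delta>"
  have c: "c > 0" using \<delta> B_f_pos by (simp add: c_def)
  have "Reg f x xstar T \<ge> - (c * real CARD('m)) * Reg_c g x T"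
    if T: "1 \<le> T" and pos: "\<forall>t\<in>{1..T}. \<forall>k. total_g g (x t) $ k > 0" for T
  proof -
    define S where "S = (\<Sum>t=1..T. total_g g (x t))"
    have "Reg f x xstar T = (\<Sum>t=1..T. total_f f t (x t) - total_f f t (xstar t))"
      by (simp add: Reg_def sum_subtractf)
    also have "\<dots> \<ge> (\<Sum>t=1..T. - (c * (\<Sum>k\<in>UNIV. total_g g (x t) $ k)))"
    proof (rule sum_mono)
      fix t assume t: "t \<in> {1..T}"
      have "total_f f t (x t) \<ge> total_f f t (xstar t) - c * (\<Sum>k\<in>UNIV. total_g g (x t) $ k)"
        unfolding c_def
      proof (rule infeasible_cost_gap[OF convex_g convex_f X_sub convex_X f_bounded z(1) \<delta>(2,1) x_in_stack])
        show "0 \<le> total_g g (x t) $ k" for k using pos t by (simp add: less_imp_le)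
        show "total_f f t (xstar t) \<le> total_f f t v" if "v \<in> feasible_set X g" for v
          using opt[of t] that by (auto simp: is_arg_min_linorder)
      qed auto
      then show "- (c * (\<Sum>k\<in>UNIV. total_g g (x t) $ k)) \<le> total_f f t (x t) - total_f f t (xstar t)" by simp
    qed
    finally have "Reg f x xstar T \<ge> (\<Sum>t=1..T. - (c * (\<Sum>k\<in>UNIV. total_g g (x t) $ k)))" .
    also have "(\<Sum>t=1..T. - (c * (\<Sum>k\<in>UNIV. total_g g (x t) $ k)))
        = - (c * (\<Sum>t=1..T. \<Sum>k\<in>UNIV. total_g g (x t) $ k))"
      by (simp only: sum_negf sum_distrib_left)
    also have "(\<Sum>t=1..T. \<Sum>k\<in>UNIV. total_g g (x t) $ k) = (\<Sum>k\<in>UNIV. S $ k)"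
      unfolding S_def sum_component by (rule sum.swap)
    finally have reg: "Reg f x xstar T \<ge> - (c * (\<Sum>k\<in>UNIV. S $ k))" .
    have "(\<Sum>k\<in>UNIV. S $ k) \<le> (\<Sum>k\<in>(UNIV::'m set). norm (pos_part S))"
    proof (rule sum_mono)
      fix k
      have "S $ k \<le> \<bar>pos_part S $ k\<bar>" by (simp add: pos_part_def)
      also have "\<dots> \<le> norm (pos_part S)" by (rule component_le_norm_cart)
      finally show "S $ k \<le> norm (pos_part S)" .
    qed
    then have "c * (\<Sum>k\<in>UNIV. S $ k) \<le> c * (real CARD('m) * Reg_c g x T)"
      using c by (intro mult_left_mono) (simp_all add: Reg_c_def S_def)
    with reg show ?thesis by simp
  qed
  moreover have "c * real CARD('m) > 0" using c by simp
  ultimately show ?thesis by blast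
qed

end

theorem theorem1:
  fixes A :: "nat \<Rightarrow> real ^ 'n::finite ^ 'n"
    and E :: "nat \<Rightarrow> ('n \<times> 'n) set"
    and a :: real and Q :: nat
    and D :: "'n \<Rightarrow> 'd::finite set"
    and X :: "'n \<Rightarrow> (real ^ 'd) set"
    and f :: "'n \<Rightarrow> nat \<Rightarrow> real ^ 'd \<Rightarrow> real"
    and g :: "'n \<Rightarrow> real ^ 'd \<Rightarrow> real ^ 'm::finite"
    and B_f C_f \<kappa> :: real
    and \<alpha> \<beta> :: "nat \<Rightarrow> real"
    and xstar x s :: "nat \<Rightarrow> real ^ 'd ^ 'n"
    and w :: "nat \<Rightarrow> real ^ 'n"
    and \<mu> y :: "nat \<Rightarrow> real ^ 'm ^ 'n"
  assumes graph: "adjacency_of A E"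
    and N1: "0 < a" "a < 1"
      "\<And>t i j. A t $ i $ j > 0 \<Longrightarrow> A t $ i $ j \<ge> a" "\<And>t i. A t $ i $ i \<ge> a"
    and N2: "\<And>t j. (\<Sum>i\<in>UNIV. A t $ i $ j) = 1"
    and N3: "Q > 0" "\<And>t. t \<ge> 1 \<Longrightarrow> strongly_connected (\<Union>l\<in>{0..Q-1}. E (t + l))"
    and X_sub: "\<And>i. X i \<subseteq> coord_space (D i)"
    and feasible: "feasible_set X g \<noteq> {}"
    and P1: "\<And>i t. convex_on (coord_space (D i)) (f i t)"
      "\<And>i k. convex_on (coord_space (D i)) (\<lambda>z. g i z $ k)"
    and P2: "\<And>i. convex (X i)" "\<And>i. compact (X i)"
    and P3: "slater D X g"
    and P4: "B_f > 0" "C_f > 0"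
      "\<And>t i u. u \<in> X i \<Longrightarrow> \<bar>f i t u\<bar> \<le> B_f"
      "\<And>t i u v. u \<in> X i \<Longrightarrow> v \<in> X i \<Longrightarrow> \<bar>f i t u - f i t v\<bar> \<le> C_f * norm (u - v)"
      "\<And>t i u v. u \<in> X i \<Longrightarrow> v \<in> subdiff (coord_space (D i)) (f i t) u \<Longrightarrow> norm v \<le> C_f"
    and opt: "\<And>t. is_arg_min (total_f f t) (\<lambda>z. z \<in> feasible_set X g) (xstar t)"
    and kappa: "0 < \<kappa>" "\<kappa> < 1 / 4"
    and alpha: "\<alpha> 0 = 1" "\<And>t. t \<ge> 1 \<Longrightarrow> \<alpha> t = 1 / sqrt (real t)"
    and beta: "\<beta> 0 = 1" "\<And>t. t \<ge> 1 \<Longrightarrow> \<beta> t = 1 / real t powr \<kappa>"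
    and run: "dopp_run A D X f g \<alpha> \<beta> x w \<mu> y s"
  shows "(\<exists>C1>0. \<exists>C2>0. \<forall>T\<ge>4.
            Reg f x xstar T \<le> C1 * real T powr (1 / 2 + 2 * \<kappa>) + C2 * path_variation \<alpha> xstar T) \<and>
         (\<exists>C>0. \<forall>T\<ge>4. \<bar>Reg_c g x T\<bar> \<le> C * real T powr (1 - \<kappa> / 2)) \<and>
         (\<exists>C>0. \<forall>T\<ge>4. (\<forall>t\<in>{1..T}. \<forall>k. total_g g (x t) $ k > 0) \<longrightarrow>
            Reg f x xstar T \<ge> C * (- (real T powr (1 - \<kappa> / 2))))"
proof -
  have w_0: "w 0 $ i = 1" for i using run by (simp add: dopp_run_def)
  have w_Suc: "w (Suc t) = mix (A t) (w t)" for t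
    using run unfolding dopp_run_def Let_def by (simp add: vec_eq_iff)
  \<comment> \<open>The constants fixed by \<open>defines\<close> are locale parameters and are
    written out here.\<close>
  interpret dopp A E a Q w "real CARD('n)" "CARD('n) * Q + 1"
    "a ^ (CARD('n) * Q + 1) * a ^ (CARD('n) * Q + 1) / real CARD('n)" D X f g B_f C_f \<kappa> \<alpha> \<beta> x s \<mu> y
    by unfold_locales (use assms w_0 w_Suc in \<open>simp_all\<close>)
  have xstar: "xstar t \<in> feasible_set X g" for t using opt[of t] by (simp add: is_arg_min_def)
  have upper: "\<exists>C1>0. \<exists>C2>0. \<forall>T\<ge>4.
      Reg f x xstar T \<le> C1 * real T powr (1 / 2 + 2 * \<kappa>) + C2 * path_variation \<alpha> xstar T"
    using regret_upper_bound[of xstar] xstar by (meson le_trans one_le_numeral)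
  obtain C where C: "C > 0" "\<And>T. T \<ge> 1 \<Longrightarrow> Reg_c g x T \<le> C * real T powr (1 - \<kappa> / 2)"
    using violation_bound[OF feasible] by blast
  have "\<bar>Reg_c g x T\<bar> = Reg_c g x T" for T by (simp add: Reg_c_def)
  then have violation: "\<exists>C>0. \<forall>T\<ge>4. \<bar>Reg_c g x T\<bar> \<le> C * real T powr (1 - \<kappa> / 2)"
    using C by (intro exI[of _ C]) simp
  obtain C' where C': "C' > 0" "\<And>T. T \<ge> 1 \<Longrightarrow> \<forall>t\<in>{1..T}. \<forall>k. total_g g (x t) $ k > 0 \<Longrightarrow>
      Reg f x xstar T \<ge> - C' * Reg_c g x T"
    using regret_lower_bound[OF opt P3] by blast
  have "Reg f x xstar T \<ge> (C' * C) * (- (real T powr (1 - \<kappa> / 2)))"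
    if "T \<ge> 4" "\<forall>t\<in>{1..T}. \<forall>k. total_g g (x t) $ k > 0" for T
  proof -
    have T: "T \<ge> 1" using that(1) by simp
    have "C' * Reg_c g x T \<le> C' * (C * real T powr (1 - \<kappa> / 2))"
      using C'(1) C(2)[OF T] by (intro mult_left_mono) auto
    with C'(2)[OF T that(2)] show ?thesis by (simp add: mult.assoc)
  qed
  moreover have "C' * C > 0" using C C' by simp
  ultimately have "\<exists>C>0. \<forall>T\<ge>4. (\<forall>t\<in>{1..T}. \<forall>k. total_g g (x t) $ k > 0) \<longrightarrow>
      Reg f x xstar T \<ge> C * (- (real T powr (1 - \<kappa> / 2)))" by blast
  with upper violation show ?thesis by blast
qed

end
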